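(* For any fixed positive integer $d$, there is an algorithm that, given any positive integer $n$, any $1\le p\le\infty$, and any nonnegative integer weights $w^1,\dots,w^d$ on $N=\{(i,j):1\le i,j\le n\}$, determines a $d$-approximative solution to the minimum nonlinear bipartite matching problem with $f=\|\cdot\|_p$ (minimizing $\|(w^1(M),\dots,w^d(M))\|_p$ over perfect matchings $M\subset N$ of $K_{n,n}$), in oracle-time which is polynomial in $n$ and $\max_{i,j,k} w^k_{i,j}$. For $p=2$ (Euclidean norm), the algorithm determines a more accurate, $\sqrt d$-approximative, solution.
   Context: $N=\{(i,j):1\le i,j\le n\}$ is the edge set of the complete bipartite graph $K_{n,n}$. For a weight function $w^k$ on $N$ write $w^k_{i,j}=w^k(i,j)$, and for $M\subseteq N$ let $w^k(M):=\sum\{w^k(i,j):(i,j)\in M\}$. The $l_p$ norm on $\mathbb{R}^d$ is $\|y\|_p=(\sum_{k=1}^d|y_k|^p)^{1/p}$ for $1\le p<\infty$ and $\|y\|_\infty=\max_{k=1}^d|y_k|$. The function $f=\|\cdot\|_p$ is presented by a comparison oracle that, queried on $y,z\in\mathbb{Z}^d$, asserts whether or not $f(y)\le f(z)$. Oracle-time means the running time plus the number of oracle queries. For a discrete optimization problem with finite set $S$ of feasible solutions and nonnegative objective function $g:S\to\mathbb{R}_+$ to be minimized or maximized, with optimal solution $s^*\in S$, an $r$-approximative solution is any $s\in S$ satisfying $\frac1r g(s^* )\le g(s)\le r\,g(s^* )$. *)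

theory Defs
  imports
    "HOL-Analysis.Analysis"
    "HOL-Library.Log_Nat"
    "HOL-Computational_Algebra.Polynomial"
begin

definition edges :: "nat \<Rightarrow> (nat \<times> nat) set" where
  "edges n = {1..n} \<times> {1..n}"

definition perfect_matchings :: "nat \<Rightarrow> (nat \<times> nat) set set" where
  "perfect_matchings n =
     {M. M \<subseteq> edges n \<and> (\<forall>i\<in>{1..n}. \<exists>!j. (i, j) \<in> M) \<and> (\<forall>j\<in>{1..n}. \<exists>!i. (i, j) \<in> M)}"

text \<open>Weights: \<open>w k i j\<close> is the weight \<open>w\<^sup>k\<close> of the edge \<open>(i, j)\<close>, where \<open>1 \<le> k \<le> d\<close> and
  \<open>1 \<le> i, j \<le> n\<close>; values outside these ranges are never used.\<close>

definition set_weight :: "(nat \<Rightarrow> nat \<Rightarrow> nat) \<Rightarrow> (nat \<times> nat) set \<Rightarrow> nat" where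
  "set_weight v M = (\<Sum>(i, j)\<in>M. v i j)"

definition weight_vector ::
    "nat \<Rightarrow> (nat \<Rightarrow> nat \<Rightarrow> nat \<Rightarrow> nat) \<Rightarrow> (nat \<times> nat) set \<Rightarrow> real list" where
  "weight_vector d w M = map (\<lambda>k. real (set_weight (w k) M)) [1..<d + 1]"

definition max_weight :: "nat \<Rightarrow> nat \<Rightarrow> (nat \<Rightarrow> nat \<Rightarrow> nat \<Rightarrow> nat) \<Rightarrow> nat" where
  "max_weight d n w = Max {w k i j | k i j. k \<in> {1..d} \<and> i \<in> {1..n} \<and> j \<in> {1..n}}"

text \<open>Vectors of length \<open>d\<close> are lists; the exponent ranges over \<open>1 \<le> p \<le> \<infinity>\<close>.\<close>

definition lp_norm :: "ereal \<Rightarrow> real list \<Rightarrow> real" where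
  "lp_norm p y =
     (if p = \<infinity> then Max (abs ` set y)
      else (\<Sum>t\<leftarrow>y. \<bar>t\<bar> powr real_of_ereal p) powr (1 / real_of_ereal p))"

definition approximative_min :: "real \<Rightarrow> 'a set \<Rightarrow> ('a \<Rightarrow> real) \<Rightarrow> 'a \<Rightarrow> bool" where
  "approximative_min r S g s \<longleftrightarrow>
     s \<in> S \<and> (\<exists>s'. is_arg_min g (\<lambda>x. x \<in> S) s' \<and> 1 / r * g s' \<le> g s \<and> g s \<le> r * g s')"

text \<open>Algorithms are programs of a random access machine with integer registers, an integer-addressed
  memory of integers and a comparison oracle. Time is measured by the logarithmic cost criterion:
  every evaluated subexpression is charged the binary length of its value (for \<open>Mem e\<close>, the length of
  the address is charged through \<open>e\<close>), and every command costs one more unit. This is polynomially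
  related to running time on Turing machines.\<close>

datatype expr =
    Num int
  | Reg nat
  | Mem expr
  | Add expr expr
  | Sub expr expr
  | Mul expr expr

datatype prog =
    Skip
  | Assign nat expr
  | Store expr expr
  | Query nat expr expr
  | Seq prog prog
  | Branch expr prog prog
  | Loop expr prog

type_synonym state = "(nat \<Rightarrow> int) \<times> (int \<Rightarrow> int)"

type_synonym oracle_fun = "int list \<Rightarrow> int list \<Rightarrow> bool"

definition bit_length :: "int \<Rightarrow> nat" where
  "bit_length x = Suc (floorlog 2 (nat \<bar>x\<bar>))"

fun expr_val :: "state \<Rightarrow> expr \<Rightarrow> int" where
  "expr_val s (Num c) = c"
| "expr_val s (Reg r) = fst s r"
| "expr_val s (Mem e) = snd s (expr_val s e)"
| "expr_val s (Add e f) = expr_val s e + expr_val s f"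
| "expr_val s (Sub e f) = expr_val s e - expr_val s f"
| "expr_val s (Mul e f) = expr_val s e * expr_val s f"

fun expr_cost :: "state \<Rightarrow> expr \<Rightarrow> nat" where
  "expr_cost s (Num c) = bit_length c"
| "expr_cost s (Reg r) = bit_length (fst s r)"
| "expr_cost s (Mem e) = bit_length (expr_val s (Mem e)) + expr_cost s e"
| "expr_cost s (Add e f) = bit_length (expr_val s (Add e f)) + expr_cost s e + expr_cost s f"
| "expr_cost s (Sub e f) = bit_length (expr_val s (Sub e f)) + expr_cost s e + expr_cost s f"
| "expr_cost s (Mul e f) = bit_length (expr_val s (Mul e f)) + expr_cost s e + expr_cost s f"

definition mem_block :: "nat \<Rightarrow> state \<Rightarrow> int \<Rightarrow> int list" where
  "mem_block d s a = map (\<lambda>k. snd s (a + int k)) [0..<d]"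

text \<open>\<open>exec d orc c s t m s'\<close>: started in \<open>s\<close>, program \<open>c\<close> halts in \<open>s'\<close> after running time \<open>t\<close> and \<open>m\<close>
  oracle queries. \<open>Query r e f\<close> asks the oracle about the two vectors of length \<open>d\<close> stored from the
  addresses \<open>e\<close> and \<open>f\<close> on. The guards of \<open>Branch\<close> and \<open>Loop\<close> hold if their value is positive.\<close>

inductive exec :: "nat \<Rightarrow> oracle_fun \<Rightarrow> prog \<Rightarrow> state \<Rightarrow> nat \<Rightarrow> nat \<Rightarrow> state \<Rightarrow> bool"
  for d :: nat and orc :: oracle_fun where
  exec_Skip: "exec d orc Skip s 1 0 s"
| exec_Assign:
    "exec d orc (Assign r e) s (1 + expr_cost s e) 0 ((fst s)(r := expr_val s e), snd s)"
| exec_Store: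
    "exec d orc (Store e f) s (1 + expr_cost s e + expr_cost s f) 0
       (fst s, (snd s)(expr_val s e := expr_val s f))"
| exec_Query:
    "\<lbrakk>y = mem_block d s (expr_val s e); z = mem_block d s (expr_val s f)\<rbrakk> \<Longrightarrow>
     exec d orc (Query r e f) s
       (1 + expr_cost s e + expr_cost s f + (\<Sum>x\<leftarrow>y @ z. bit_length x)) 1
       ((fst s)(r := (if orc y z then 1 else 0)), snd s)"
| exec_Seq:
    "\<lbrakk>exec d orc a s t m s'; exec d orc b s' t' m' s''\<rbrakk> \<Longrightarrow>
     exec d orc (Seq a b) s (t + t') (m + m') s''"
| exec_Branch:
    "exec d orc (if expr_val s e > 0 then a else b) s t m s' \<Longrightarrow>
     exec d orc (Branch e a b) s (1 + expr_cost s e + t) m s'"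
| exec_Loop_False:
    "\<not> expr_val s e > 0 \<Longrightarrow> exec d orc (Loop e a) s (1 + expr_cost s e) 0 s"
| exec_Loop_True:
    "\<lbrakk>expr_val s e > 0; exec d orc a s t m s'; exec d orc (Loop e a) s' t' m' s''\<rbrakk> \<Longrightarrow>
     exec d orc (Loop e a) s (1 + expr_cost s e + t + t') (m + m') s''"

inductive_cases exec_SkipE: "exec d orc Skip s t m s'"
inductive_cases exec_AssignE: "exec d orc (Assign r e) s t m s'"
inductive_cases exec_StoreE: "exec d orc (Store e f) s t m s'"
inductive_cases exec_QueryE: "exec d orc (Query r e f) s t m s'"
inductive_cases exec_SeqE: "exec d orc (Seq a b) s t m s'"
inductive_cases exec_BranchE: "exec d orc (Branch e a b) s t m s'"
inductive_cases exec_LoopE: "exec d orc (Loop e a) s t m s'"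

text \<open>Hence a halting run, its result and its cost are unique.\<close>

lemma exec_deterministic:
  assumes "exec d orc c s t m s'" and "exec d orc c s t' m' s''"
  shows "t' = t \<and> m' = m \<and> s'' = s'"
  using assms
proof (induction arbitrary: t' m' s'' rule: exec.induct)
  case (exec_Skip s)
  then show ?case by (auto elim: exec_SkipE)
next
  case (exec_Assign r e s)
  then show ?case by (auto elim: exec_AssignE)
next
  case (exec_Store e f s)
  then show ?case by (auto elim: exec_StoreE)
next
  case (exec_Query y s e z f r)
  from exec_Query(3) show ?case
    by (rule exec_QueryE) (simp add: exec_Query(1,2))
next
  case (exec_Seq a s t1 m1 s1 b t2 m2 s2)
  from exec_Seq.prems show ?case
  proof (rule exec_SeqE)
    fix t3 m3 s3 t4 m4
    assume *: "t' = t3 + t4" "m' = m3 + m4"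
      and a: "exec d orc a s t3 m3 s3" and b: "exec d orc b s3 t4 m4 s''"
    from exec_Seq.IH(1)[OF a] exec_Seq.IH(2)[of t4 m4 s''] b * show ?thesis
      by simp
  qed
next
  case (exec_Branch s e a b t m s1)
  from exec_Branch.prems show ?case
    by (rule exec_BranchE) (use exec_Branch.IH in simp)
next
  case (exec_Loop_False s e a)
  from exec_Loop_False.prems show ?case
    by (rule exec_LoopE) (use exec_Loop_False.hyps in simp_all)
next
  case (exec_Loop_True s e a t1 m1 s1 t2 m2 s2)
  from exec_Loop_True.prems show ?case
  proof (rule exec_LoopE)
    assume "\<not> expr_val s e > 0"
    with exec_Loop_True.hyps(1) show ?thesis
      by simp
  next
    fix t3 m3 s3 t4 m4
    assume *: "t' = Suc (expr_cost s e + t3 + t4)" "m' = m3 + m4"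
      and a: "exec d orc a s t3 m3 s3" and b: "exec d orc (Loop e a) s3 t4 m4 s''"
    from exec_Loop_True.IH(1)[OF a] exec_Loop_True.IH(2)[of t4 m4 s''] b * show ?thesis
      by simp
  qed
qed

definition comparison_oracle :: "(real list \<Rightarrow> real) \<Rightarrow> oracle_fun" where
  "comparison_oracle f y z \<longleftrightarrow> f (map real_of_int y) \<le> f (map real_of_int z)"

text \<open>The input occupies the cells \<open>0, \<dots>, d n\<^sup>2\<close>: first \<open>n\<close>, then the weights, lexicographically by
  \<open>(k, i, j)\<close>. The norm is accessible to the program only through the oracle.\<close>

definition input_list :: "nat \<Rightarrow> nat \<Rightarrow> (nat \<Rightarrow> nat \<Rightarrow> nat \<Rightarrow> nat) \<Rightarrow> int list" where
  "input_list d n w =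
     int n # [int (w k i j). k \<leftarrow> [1..<d + 1], i \<leftarrow> [1..<n + 1], j \<leftarrow> [1..<n + 1]]"

definition initial_state :: "int list \<Rightarrow> state" where
  "initial_state xs =
     (\<lambda>r. 0, \<lambda>a. if 0 \<le> a \<and> a < int (length xs) then xs ! nat a else 0)"

text \<open>The output is read from the cells \<open>1, \<dots>, n\<close>: cell \<open>i\<close> holds the partner of the left vertex \<open>i\<close>.\<close>

definition output_edges :: "nat \<Rightarrow> state \<Rightarrow> (nat \<times> nat) set" where
  "output_edges n s = {(i, nat (snd s (int i))) | i. i \<in> {1..n}}"

definition poly2 :: "nat poly poly \<Rightarrow> nat \<Rightarrow> nat \<Rightarrow> nat" where
  "poly2 q x y = poly (poly q [:x:]) y"

end

theory Submission imports Defs begin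

text \<open>
  The \<open>d\<close> weights of each edge are added up, and a perfect matching \<open>M\<close> of minimum total weight is
  computed. The total weight of a matching is the \<open>l\<^sub>1\<close> norm of its weight vector \<open>y\<close>, and
  \<open>\<parallel>y\<parallel>\<^sub>p \<le> \<parallel>y\<parallel>\<^sub>1 \<le> d \<parallel>y\<parallel>\<^sub>p\<close>, where Cauchy-Schwarz improves the factor \<open>d\<close> to \<open>sqrt d\<close> for \<open>p = 2\<close>
  (\<open>lp_norm_le_sum\<close>, \<open>sum_le_length_lp_norm\<close>, \<open>sum_le_sqrt_length_euclidean_norm\<close>). Hence \<open>M\<close> is as good
  an approximation for the \<open>l\<^sub>p\<close> norm as claimed (\<open>surrogate_minimizer_approximative\<close>), simultaneously for
  all \<open>p\<close>.

  It remains to solve the assignment problem on the random access machine, in time polynomial in \<open>n\<close> and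
  in the largest weight \<open>W\<close>. As a dependence on the weights themselves, rather than on their binary
  length, is permitted, Bertsekas' auction algorithm in its simplest form will do: an unassigned left
  vertex takes the object (right vertex) with the least sum of cost and price, the price of this object
  goes up by one, and a previous owner becomes unassigned. Costs are the total weights multiplied by
  \<open>n + 1\<close>. Objects not yet taken are free of charge, so no price exceeds the largest cost by more than one;
  therefore there are at most \<open>n ((n + 1) d W + 1)\<close> rounds (\<open>auction_step\<close>). In the end every owner is
  within one unit of his best choice, so the total cost is within \<open>n\<close> of the minimum, and divisibility of
  all costs by \<open>n + 1\<close> makes it exactly minimal (\<open>almost_equilibrium_optimal\<close>). This algorithm needs
  neither augmenting paths nor shortest paths, and its whole state consists of two arrays.

  For the running time, all values stored at the heads of loops are at most
  \<open>V = 2 (n + 1) d W + n + 2\<close>. A loop-free piece of program started from values bounded by \<open>V\<close> takes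
  time at most \<open>V ^ k\<close> with an exponent \<open>k\<close> that depends only on its text (\<open>exec_straight_line\<close>), and every
  loop makes fewer than \<open>V\<^sup>2\<close> iterations (\<open>timed_triple_Loop\<close>). So the program halts within time \<open>V ^ K\<close>,
  where \<open>K\<close> depends on \<open>d\<close> only (\<open>matching_prog_correct\<close>).
\<close>

section \<open>Norms\<close>

lemma abs_le_lp_norm:
  assumes "1 \<le> p" and "t \<in> set y"
  shows "\<bar>t\<bar> \<le> lp_norm p y"
proof (cases "p = \<infinity>")
  case True
  then show ?thesis
    using assms(2) by (simp add: lp_norm_def)
next
  case False
  with assms(1) obtain r where p: "p = ereal r" and r: "1 \<le> r"
    by (cases p) auto
  have "\<bar>t\<bar> powr r \<le> (\<Sum>u\<leftarrow>y. \<bar>u\<bar> powr r)"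
    using assms(2) by (intro member_le_sum_list) auto
  then have "(\<bar>t\<bar> powr r) powr (1 / r) \<le> lp_norm p y"
    using r by (simp add: lp_norm_def p powr_mono2)
  with r show ?thesis
    by (simp add: powr_powr)
qed

lemma lp_norm_le_sum:
  assumes "1 \<le> p" and "y \<noteq> []"
  shows "lp_norm p y \<le> (\<Sum>t\<leftarrow>y. \<bar>t\<bar>)"
proof (cases "p = \<infinity>")
  case True
  have "\<bar>t\<bar> \<le> (\<Sum>t\<leftarrow>y. \<bar>t\<bar>)" if "t \<in> set y" for t
    using that by (intro member_le_sum_list) auto
  with True assms(2) show ?thesis
    by (simp add: lp_norm_def)
next
  case False
  with assms(1) obtain r where p: "p = ereal r" and r: "1 \<le> r"
    by (cases p) auto
  define S where "S = (\<Sum>t\<leftarrow>y. \<bar>t\<bar>)"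
  have S: "0 \<le> S"
    unfolding S_def by (intro sum_list_nonneg) auto
  \<comment> \<open>After scaling to \<open>S = 1\<close>, this says \<open>t powr r \<le> t\<close> for \<open>0 \<le> t \<le> 1\<close>.\<close>
  have step: "\<bar>t\<bar> powr r \<le> \<bar>t\<bar> * S powr (r - 1)" if "t \<in> set y" for t
  proof -
    have "\<bar>t\<bar> \<le> S"
      unfolding S_def using that by (intro member_le_sum_list) auto
    then have "\<bar>t\<bar> powr (r - 1) \<le> S powr (r - 1)"
      using r by (intro powr_mono2) auto
    then have "\<bar>t\<bar> * \<bar>t\<bar> powr (r - 1) \<le> \<bar>t\<bar> * S powr (r - 1)"
      by (intro mult_left_mono) auto
    then show ?thesis
      by (simp add: powr_mult_base)
  qed
  have "(\<Sum>t\<leftarrow>y. \<bar>t\<bar> powr r) \<le> (\<Sum>t\<leftarrow>y. \<bar>t\<bar> * S powr (r - 1))"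
    using step by (rule sum_list_mono)
  also have "\<dots> = S * S powr (r - 1)"
    by (simp add: S_def sum_list_mult_const)
  also have "\<dots> = S powr r"
    using S by (simp add: powr_mult_base)
  finally have "(\<Sum>t\<leftarrow>y. \<bar>t\<bar> powr r) powr (1 / r) \<le> (S powr r) powr (1 / r)"
    using r by (intro powr_mono2 sum_list_nonneg) auto
  with r S show ?thesis
    by (simp add: lp_norm_def p powr_powr S_def)
qed

text \<open>Every coordinate is at most the norm, so the sum exceeds the norm by at most a factor of the number of
  coordinates. Hoelder would give the factor \<open>d powr (1 - 1 / p)\<close>, but the cruder bound suffices; for
  \<open>p = 2\<close> the sharp factor \<open>sqrt d\<close> follows from the Cauchy-Schwarz inequality.\<close>

lemma sum_le_length_lp_norm:
  assumes "1 \<le> p"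
  shows "(\<Sum>t\<leftarrow>y. \<bar>t\<bar>) \<le> length y * lp_norm p y"
proof -
  have "(\<Sum>t\<leftarrow>y. \<bar>t\<bar>) \<le> (\<Sum>t\<leftarrow>y. lp_norm p y)"
    using abs_le_lp_norm[OF assms] by (intro sum_list_mono)
  then show ?thesis
    by (simp add: sum_list_triv)
qed

lemma sum_le_sqrt_length_euclidean_norm: "(\<Sum>t\<leftarrow>y. \<bar>t\<bar>) \<le> sqrt (length y) * lp_norm 2 y"
proof -
  have "(\<Sum>t\<leftarrow>y. \<bar>t\<bar>)\<^sup>2 \<le> (\<Sum>t\<leftarrow>y. t\<^sup>2) * length y"
    using sum_squared_le_sum_of_squares[of "\<lambda>i. \<bar>y ! i\<bar>" "{0..<length y}"]
    by (simp add: sum_list_sum_nth)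
  then have "(\<Sum>t\<leftarrow>y. \<bar>t\<bar>) \<le> sqrt ((\<Sum>t\<leftarrow>y. t\<^sup>2) * length y)"
    by (rule real_le_rsqrt)
  moreover have "0 \<le> (\<Sum>t\<leftarrow>y. t\<^sup>2)"
    by (intro sum_list_nonneg) auto
  ultimately show ?thesis
    by (simp add: lp_norm_def powr_half_sqrt real_sqrt_mult mult.commute)
qed

text \<open>Minimizing \<open>h\<close> instead of \<open>g\<close> loses at most the factor by which \<open>h\<close> overestimates \<open>g\<close>: for a
  minimizer \<open>x\<close> of \<open>g\<close>, \<open>g s \<le> h s \<le> h x \<le> r * g x\<close>.\<close>

lemma surrogate_minimizer_approximative:
  fixes g h :: "'a \<Rightarrow> real"
  assumes "finite S" and s: "s \<in> S" and min: "\<And>x. x \<in> S \<Longrightarrow> h s \<le> h x"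
    and r: "1 \<le> r"
    and gh: "\<And>x. x \<in> S \<Longrightarrow> 0 \<le> g x \<and> g x \<le> h x \<and> h x \<le> r * g x"
  shows "approximative_min r S g s"
proof -
  define x where "x = arg_min_on g S"
  have x: "x \<in> S" and opt: "\<And>y. y \<in> S \<Longrightarrow> g x \<le> g y"
    unfolding x_def using assms(1) s by (auto intro: arg_min_if_finite arg_min_least)
  have "is_arg_min g (\<lambda>x. x \<in> S) x"
    using x opt by (auto simp: is_arg_min_def not_less)
  moreover have "1 / r * g x \<le> g s"
  proof -
    have "1 / r * g x \<le> 1 * g x"
      using r gh[OF x] by (intro mult_right_mono) auto
    with opt[OF s] show ?thesis by simp
  qed
  moreover have "g s \<le> r * g x"
    using gh[OF s] gh[OF x] min[OF x] by linarith
  ultimately show ?thesis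
    using s by (auto simp: approximative_min_def)
qed

section \<open>Perfect matchings as bijections\<close>

text \<open>The bijection goes from right to left vertices, as the auction records the owner of each
  object \<open>j\<close>.\<close>

definition matching_of :: "nat \<Rightarrow> (nat \<Rightarrow> nat) \<Rightarrow> (nat \<times> nat) set" where
  "matching_of n \<sigma> = (\<lambda>j. (\<sigma> j, j)) ` {1..n}"

lemma matching_of_perfect:
  assumes "bij_betw \<sigma> {1..n} {1..n}"
  shows "matching_of n \<sigma> \<in> perfect_matchings n"
proof -
  have inj: "\<And>j j'. j \<in> {1..n} \<Longrightarrow> j' \<in> {1..n} \<Longrightarrow> \<sigma> j = \<sigma> j' \<Longrightarrow> j = j'"
    and im: "\<sigma> ` {1..n} = {1..n}"
    using assms unfolding bij_betw_def by (blast dest: inj_onD)+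
  have mem: "(i, j) \<in> matching_of n \<sigma> \<longleftrightarrow> j \<in> {1..n} \<and> i = \<sigma> j" for i j
    unfolding matching_of_def by blast
  have "\<exists>!j. (i, j) \<in> matching_of n \<sigma>" if "i \<in> {1..n}" for i
  proof -
    from that im obtain j where "j \<in> {1..n}" "\<sigma> j = i" by (metis imageE)
    then show ?thesis
      unfolding mem using inj by blast
  qed
  moreover have "\<exists>!i. (i, j) \<in> matching_of n \<sigma>" if "j \<in> {1..n}" for j
    using that unfolding mem by blast
  moreover have "matching_of n \<sigma> \<subseteq> edges n"
    using im by (auto simp: matching_of_def edges_def)
  ultimately show ?thesis
    by (simp add: perfect_matchings_def)
qed

lemma perfect_matching_bijectionE:
  assumes "M \<in> perfect_matchings n"
  obtains \<sigma> where "bij_betw \<sigma> {1..n} {1..n}" and "M = matching_of n \<sigma>"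
proof
  have sub: "M \<subseteq> {1..n} \<times> {1..n}"
    and left: "\<And>i. i \<in> {1..n} \<Longrightarrow> \<exists>!j. (i, j) \<in> M"
    and right: "\<And>j. j \<in> {1..n} \<Longrightarrow> \<exists>!i. (i, j) \<in> M"
    using assms by (auto simp: perfect_matchings_def edges_def)
  define \<sigma> where "\<sigma> j = (THE i. (i, j) \<in> M)" for j
  have \<sigma>: "(i, j) \<in> M \<longleftrightarrow> j \<in> {1..n} \<and> i = \<sigma> j" for i j
    using sub theI'[OF right, of j] right[of j] unfolding \<sigma>_def by blast
  show "M = matching_of n \<sigma>"
    using \<sigma> by (auto simp: matching_of_def)
  show "bij_betw \<sigma> {1..n} {1..n}"
    unfolding bij_betw_def inj_on_def
  proof (intro conjI ballI impI equalityI subsetI)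
    fix j j' assume "j \<in> {1..n}" "j' \<in> {1..n}" "\<sigma> j = \<sigma> j'"
    then show "j = j'" using \<sigma> sub left by blast
  next
    fix i assume "i \<in> \<sigma> ` {1..n}"
    then show "i \<in> {1..n}" using \<sigma> sub by blast
  next
    fix i assume "i \<in> {1..n}"
    then show "i \<in> \<sigma> ` {1..n}" using \<sigma> left by blast
  qed
qed

lemma set_weight_matching_of: "set_weight v (matching_of n \<sigma>) = (\<Sum>j\<in>{1..n}. v (\<sigma> j) j)"
  unfolding set_weight_def matching_of_def
  by (subst sum.reindex) (auto simp: inj_on_def)

lemma finite_perfect_matchings: "finite (perfect_matchings n)"
  by (rule finite_subset[of _ "Pow (edges n)"]) (auto simp: perfect_matchings_def edges_def)

section \<open>The auction\<close>

text \<open>The left vertices act as bidders and the right vertices as objects. Bidder \<open>i\<close> obtains object \<open>j\<close> at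
  total expense \<open>c i j + price j\<close>. Bidders enter one after the other; \<open>1, \<dots>, m\<close> have entered, and all of
  them own an object except for the current \<open>bidder\<close>. The value \<open>0\<close> of \<open>owner\<close> marks a free object. The
  auction is over when the fictitious bidder \<open>n + 1\<close> enters.

  The last clause is almost-optimality: an owner could save at most \<open>1\<close> by moving to another object.
  A free object keeps the price \<open>0\<close>, which is what keeps all prices bounded.\<close>

definition auction_inv ::
    "nat \<Rightarrow> (nat \<Rightarrow> nat \<Rightarrow> nat) \<Rightarrow> nat \<Rightarrow> (nat \<Rightarrow> nat) \<Rightarrow> (nat \<Rightarrow> nat) \<Rightarrow> nat \<Rightarrow> nat \<Rightarrow> bool" where
  "auction_inv n c B price owner bidder m \<longleftrightarrow>
     1 \<le> bidder \<and> bidder \<le> m \<and> m \<le> n + 1 \<and> (bidder \<le> n \<longrightarrow> m \<le> n) \<and>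
     bij_betw owner {j \<in> {1..n}. owner j \<noteq> 0} ({1..m} - {bidder}) \<and>
     (\<forall>j\<in>{1..n}. price j \<le> B + 1 \<and> (owner j = 0 \<longrightarrow> price j = 0)) \<and>
     (\<forall>j\<in>{1..n}. \<forall>j'\<in>{1..n}. owner j \<noteq> 0 \<longrightarrow>
        c (owner j) j + price j \<le> c (owner j) j' + price j' + 1)"

lemma auction_inv_init: 
  assumes "n \<ge> 1"
  shows "auction_inv n c B (\<lambda>_. 0) (\<lambda>_. 0) 1 1"
  using assms by (simp add: auction_inv_def bij_betw_def)

text \<open>While a genuine bidder is waiting, fewer than \<open>n\<close> bidders own an object.\<close>

lemma auction_free_object:
  assumes inv: "auction_inv n c B price owner bidder m" and "bidder \<le> n"
  obtains j where "j \<in> {1..n}" and "owner j = 0"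
proof -
  have "\<exists>j\<in>{1..n}. owner j = 0"
  proof (rule ccontr)
    assume "\<not> (\<exists>j\<in>{1..n}. owner j = 0)"
    then have "{j \<in> {1..n}. owner j \<noteq> 0} = {1..n}" by auto
    then have "bij_betw owner {1..n} ({1..m} - {bidder})"
      using inv by (simp add: auction_inv_def)
    then have "card {1..n} = card ({1..m} - {bidder})"
      by (rule bij_betw_same_card)
    with inv assms(2) show False
      by (auto simp: auction_inv_def)
  qed
  with that show ?thesis by blast
qed

text \<open>No price ever exceeds \<open>B + 1\<close> and each round raises one price by \<open>1\<close>, so this quantity bounds the
  number of rounds to come.\<close>

definition remaining_raises :: "nat \<Rightarrow> nat \<Rightarrow> (nat \<Rightarrow> nat) \<Rightarrow> nat" where
  "remaining_raises n B price = (\<Sum>j\<in>{1..n}. B + 1 - price j)"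

text \<open>One round: the bidder takes a cheapest object \<open>b\<close>, whose price goes up by \<open>1\<close>; its previous owner,
  if there is one, bids next, and otherwise a new bidder enters. Since \<open>b\<close> was cheapest, the raised
  price makes the new owner lose at most \<open>1\<close>. For all other owners only a price of an object that they do
  not own has gone up, which cannot make them less satisfied.\<close>

lemma auction_step:
  assumes inv: "auction_inv n c B price owner bidder m" and act: "bidder \<le> n"
    and B: "\<And>i j. i \<in> {1..n} \<Longrightarrow> j \<in> {1..n} \<Longrightarrow> c i j \<le> B"
    and b: "b \<in> {1..n}"
    and best: "\<And>j. j \<in> {1..n} \<Longrightarrow> c bidder b + price b \<le> c bidder j + price j"
    and upd: "price' = price(b := price b + 1)" "owner' = owner(b := bidder)"
      "bidder' = (if owner b > 0 then owner b else m + 1)"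
      "m' = (if owner b > 0 then m else m + 1)"
  shows "auction_inv n c B price' owner' bidder' m'"
    and "remaining_raises n B price' < remaining_raises n B price"
proof -
  have basic: "1 \<le> bidder" "bidder \<le> m" "m \<le> n"
    and bij: "bij_betw owner {j \<in> {1..n}. owner j \<noteq> 0} ({1..m} - {bidder})"
    and price: "\<And>j. j \<in> {1..n} \<Longrightarrow> price j \<le> B + 1"
      "\<And>j. j \<in> {1..n} \<Longrightarrow> owner j = 0 \<Longrightarrow> price j = 0"
    and slack: "\<And>j j'. j \<in> {1..n} \<Longrightarrow> j' \<in> {1..n} \<Longrightarrow> owner j \<noteq> 0 \<Longrightarrow>
        c (owner j) j + price j \<le> c (owner j) j' + price j' + 1"
    using inv act by (auto simp: auction_inv_def)
  obtain f where f: "f \<in> {1..n}" "owner f = 0"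
    using auction_free_object[OF inv act] .
  \<comment> \<open>A free object costs at most \<open>B\<close>, so nobody bids for an object whose price exceeds \<open>B\<close>.\<close>
  have low: "price b \<le> B"
    using best[OF f(1)] price(2)[OF f] B[of bidder f] f(1) basic act by fastforce
  have ob: "owner b \<noteq> 0 \<Longrightarrow> owner b \<in> {1..m} - {bidder}"
    using bij_betwE[OF bij] b by blast
  have "bij_betw owner' {j \<in> {1..n}. owner' j \<noteq> 0} ({1..m'} - {bidder'})"
  proof -
    let ?D = "{j \<in> {1..n}. owner j \<noteq> 0}"
    have "bij_betw owner (?D - {b}) ({1..m} - {bidder} - {owner b})"
    proof (cases "owner b = 0")
      case True
      then have "?D - {b} = ?D" "{1..m} - {bidder} - {owner b} = {1..m} - {bidder}" by auto
      with bij show ?thesis by simp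
    next
      case False
      then show ?thesis
        using bij_betw_DiffI[OF bij, of "{b}" "{owner b}"] b ob by (simp add: bij_betw_def)
    qed
    then have "bij_betw owner' (?D - {b}) ({1..m} - {bidder} - {owner b})"
      by (rule bij_betw_cong[THEN iffD1, rotated]) (simp add: upd)
    moreover have "bij_betw owner' {b} {bidder}"
      by (simp add: upd)
    ultimately have "bij_betw owner' (?D - {b} \<union> {b}) ({1..m} - {bidder} - {owner b} \<union> {bidder})"
      by (rule bij_betw_combine) auto
    moreover have "?D - {b} \<union> {b} = {j \<in> {1..n}. owner' j \<noteq> 0}"
      using b basic by (auto simp: upd)
    moreover have "{1..m} - {bidder} - {owner b} \<union> {bidder} = {1..m'} - {bidder'}"
      using basic ob by (auto simp: upd)
    ultimately show ?thesis by simp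
  qed
  moreover have "1 \<le> bidder'" "bidder' \<le> m'" "m' \<le> n + 1" "bidder' \<le> n \<longrightarrow> m' \<le> n"
    using basic ob by (auto simp: upd)
  moreover have "\<forall>j\<in>{1..n}. price' j \<le> B + 1 \<and> (owner' j = 0 \<longrightarrow> price' j = 0)"
    using price low basic by (auto simp: upd)
  moreover have "c (owner' j) j + price' j \<le> c (owner' j) j' + price' j' + 1"
    if "j \<in> {1..n}" "j' \<in> {1..n}" "owner' j \<noteq> 0" for j j'
  proof -
    have "price j' \<le> price' j'" by (simp add: upd)
    then show ?thesis
      using that slack[of j j'] best[of j'] by (cases "j = b") (auto simp: upd)
  qed
  ultimately show "auction_inv n c B price' owner' bidder' m'"
    by (simp add: auction_inv_def)
  show "remaining_raises n B price' < remaining_raises n B price"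
    unfolding remaining_raises_def using b low
    by (intro sum_strict_mono_ex1) (auto simp: upd)
qed

text \<open>By then \<open>n\<close> bidders own distinct objects among \<open>n\<close>, so no object is left free.\<close>

lemma auction_finished:
  assumes inv: "auction_inv n c B price owner bidder m" and "\<not> bidder \<le> n"
  shows "bij_betw owner {1..n} {1..n}"
    and "\<And>j j'. j \<in> {1..n} \<Longrightarrow> j' \<in> {1..n} \<Longrightarrow>
      c (owner j) j + price j \<le> c (owner j) j' + price j' + 1"
proof -
  let ?D = "{j \<in> {1..n}. owner j \<noteq> 0}"
  have eq: "{1..m} - {bidder} = {1..n}"
    using inv assms(2) by (auto simp: auction_inv_def)
  then have bij: "bij_betw owner ?D {1..n}"
    using inv by (simp add: auction_inv_def)
  then have "card ?D = card {1..n}"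
    by (rule bij_betw_same_card)
  then have D: "?D = {1..n}"
    by (intro card_subset_eq) auto
  with bij show "bij_betw owner {1..n} {1..n}" by simp
  fix j j' assume "j \<in> {1..n}" "j' \<in> {1..n}"
  with D inv show "c (owner j) j + price j \<le> c (owner j) j' + price j' + 1"
    unfolding auction_inv_def by blast
qed

text \<open>Prices are dual variables of the assignment problem. If every owner is within \<open>1\<close> of his optimum, then
  adding up over all bidders, the prices cancel, and the total cost is within \<open>n\<close> of the minimum. Costs
  that are multiples of \<open>n + 1\<close> turn this into exact optimality.\<close>

lemma almost_equilibrium_optimal:
  assumes bij: "bij_betw owner {1..n} {1..n}"
    and slack: "\<And>j j'. j \<in> {1..n} \<Longrightarrow> j' \<in> {1..n} \<Longrightarrow>
      (n + 1) * v (owner j) j + price j \<le> (n + 1) * v (owner j) j' + price j' + 1"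
    and M: "M \<in> perfect_matchings n"
  shows "set_weight v (matching_of n owner) \<le> set_weight v M"
proof -
  obtain \<sigma> where \<sigma>: "bij_betw \<sigma> {1..n} {1..n}" and M_eq: "M = matching_of n \<sigma>"
    using perfect_matching_bijectionE[OF M] .
  \<comment> \<open>In the competing matching, object \<open>j\<close> goes to the bidder who owns \<open>\<tau> j\<close> in the auction.\<close>
  define \<tau> where "\<tau> = inv_into {1..n} owner \<circ> \<sigma>"
  have \<tau>: "bij_betw \<tau> {1..n} {1..n}"
    unfolding \<tau>_def by (rule bij_betw_trans[OF \<sigma> bij_betw_inv_into[OF bij]])
  have own: "owner (\<tau> j) = \<sigma> j" if "j \<in> {1..n}" for j
    unfolding \<tau>_def comp_def
    using bij_betw_inv_into_right[OF bij] bij_betwE[OF \<sigma>] that by blast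
  have reindex: "(\<Sum>j\<in>{1..n}. f (\<tau> j)) = (\<Sum>j\<in>{1..n}. f j)" for f :: "nat \<Rightarrow> nat"
    by (rule sum.reindex_bij_betw[OF \<tau>])
  have "(\<Sum>j\<in>{1..n}. (n + 1) * v (owner (\<tau> j)) (\<tau> j) + price (\<tau> j))
      \<le> (\<Sum>j\<in>{1..n}. (n + 1) * v (\<sigma> j) j + price j + 1)"
  proof (rule sum_mono)
    fix j assume j: "j \<in> {1..n}"
    then have "\<tau> j \<in> {1..n}" using bij_betwE[OF \<tau>] by blast
    from slack[OF this j] show "(n + 1) * v (owner (\<tau> j)) (\<tau> j) + price (\<tau> j)
      \<le> (n + 1) * v (\<sigma> j) j + price j + 1"
      by (simp only: own[OF j])
  qed
  then have "(n + 1) * (\<Sum>j\<in>{1..n}. v (owner j) j) + (\<Sum>j\<in>{1..n}. price j)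
      \<le> (n + 1) * (\<Sum>j\<in>{1..n}. v (\<sigma> j) j) + (\<Sum>j\<in>{1..n}. price j) + n"
    using reindex[of "\<lambda>j. (n + 1) * v (owner j) j + price j"]
    by (simp add: sum.distrib sum_distrib_left sum_Suc del: mult_Suc)
  \<comment> \<open>Both matchings have a cost divisible by \<open>n + 1\<close>, which absorbs the defect of \<open>n\<close>.\<close>
  then have "(n + 1) * set_weight v (matching_of n owner) < (n + 1) * (set_weight v M + 1)"
    by (simp add: set_weight_matching_of M_eq)
  then show ?thesis
    by (simp only: mult_less_cancel1) simp
qed

section \<open>Running times of programs\<close>

definition bounded_state :: "nat \<Rightarrow> state \<Rightarrow> bool" where
  "bounded_state V s \<longleftrightarrow> (\<forall>r. \<bar>fst s r\<bar> \<le> int V) \<and> (\<forall>a. \<bar>snd s a\<bar> \<le> int V)"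

text \<open>Costs are estimated in powers of a bound \<open>V \<ge> 2\<close> on the contents of all registers and memory cells:
  the degree of an expression or of a loop-free program depends only on the program text, while
  \<open>V ^ degree\<close> bounds both the values that it computes and the time that it takes. A constant \<open>c\<close> is
  covered because \<open>\<bar>c\<bar> < 2 ^ nat \<bar>c\<bar>\<close>.\<close>

fun expr_degree :: "expr \<Rightarrow> nat" where
  "expr_degree (Num c) = nat \<bar>c\<bar> + 2"
| "expr_degree (Reg r) = 2"
| "expr_degree (Mem e) = expr_degree e + 2"
| "expr_degree (Add e f) = expr_degree e + expr_degree f + 2"
| "expr_degree (Sub e f) = expr_degree e + expr_degree f + 2"
| "expr_degree (Mul e f) = expr_degree e + expr_degree f + 2"

lemma bit_length_le: "bit_length x \<le> nat \<bar>x\<bar> + 1"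
proof -
  have "floorlog 2 m \<le> m" for m
  proof (cases "m = 0")
    case False
    have "m < 2 ^ m" by simp
    then show ?thesis
      using floorlog_leI[of m 2 m] by simp
  qed (simp add: floorlog_def)
  then show ?thesis by (simp add: bit_length_def)
qed

lemma power_sum_le:
  fixes V :: nat
  assumes "2 \<le> V"
  shows "V ^ a + V ^ b \<le> V ^ (a + b + 1)"
proof -
  have "V ^ a \<le> V ^ (a + b)" "V ^ b \<le> V ^ (a + b)"
    using assms by (auto intro: power_increasing)
  moreover have "2 * V ^ (a + b) \<le> V * V ^ (a + b)"
    using assms by (rule mult_right_mono) simp
  ultimately have "V ^ a + V ^ b \<le> V * V ^ (a + b)" by linarith
  then show ?thesis by simp
qed

lemma power_combination_le:
  fixes V :: nat
  assumes V: "2 \<le> V" and ab: "2 \<le> a" "2 \<le> b"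
  shows "2 * V ^ a + 2 * V ^ b + 1 \<le> V ^ (a + b + 2)" and "V ^ (a + b) + V ^ a + V ^ b + 1 \<le> V ^ (a + b + 2)"
proof -
  have pos: "1 \<le> V ^ (a + b)" "4 \<le> V ^ 2"
    using V power_mono[OF V, of 2] by auto
  have dbl: "2 * V ^ x \<le> V ^ (a + b)" if "x + 2 \<le> a + b" for x
  proof -
    have "2 * V ^ x \<le> V * V ^ x" using V by simp
    also have "\<dots> = V ^ (x + 1)" by simp
    also have "\<dots> \<le> V ^ (a + b)" using V that by (intro power_increasing) auto
    finally show ?thesis .
  qed
  have "4 * V ^ (a + b) \<le> V ^ 2 * V ^ (a + b)"
    using pos(2) by (rule mult_right_mono) simp
  then have four: "4 * V ^ (a + b) \<le> V ^ (a + b + 2)"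
    by (simp only: power_add mult.commute)
  have "V ^ a + V ^ b \<le> V ^ (a + b)"
    using dbl[of a] dbl[of b] ab by simp
  with four pos dbl[of a] dbl[of b] ab
  show "2 * V ^ a + 2 * V ^ b + 1 \<le> V ^ (a + b + 2)"
    and "V ^ (a + b) + V ^ a + V ^ b + 1 \<le> V ^ (a + b + 2)"
    by linarith+
qed

lemma expr_degree_ge_2: "2 \<le> expr_degree e"
  by (induction e) auto

lemma expr_bounds:
  assumes s: "bounded_state V s" and V: "2 \<le> V"
  shows "\<bar>expr_val s e\<bar> \<le> int (V ^ expr_degree e)" and "expr_cost s e \<le> V ^ expr_degree e"
proof -
  have V2: "V + 1 \<le> V ^ 2"
  proof -
    have "2 * V \<le> V * V" using V by simp
    with V show ?thesis unfolding power2_eq_square by linarith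
  qed
  have "\<bar>expr_val s e\<bar> \<le> int (V ^ expr_degree e) \<and> expr_cost s e \<le> V ^ expr_degree e"
  proof (induction e)
    case (Num c)
    have "nat \<bar>c\<bar> + 1 \<le> 2 ^ (nat \<bar>c\<bar> + 2)"
      using less_exp[of "nat \<bar>c\<bar> + 2"] by linarith
    also have "\<dots> \<le> V ^ (nat \<bar>c\<bar> + 2)"
      using V by (rule power_mono) simp
    finally have "nat \<bar>c\<bar> + 1 \<le> V ^ (nat \<bar>c\<bar> + 2)" .
    then have "\<bar>c\<bar> \<le> int (V ^ (nat \<bar>c\<bar> + 2))" and "bit_length c \<le> V ^ (nat \<bar>c\<bar> + 2)"
      using bit_length_le[of c] by linarith+
    then show ?case
      by (simp only: expr_val.simps expr_cost.simps expr_degree.simps)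
  next
    case (Reg r)
    have "nat \<bar>fst s r\<bar> \<le> V"
      using s by (simp add: bounded_state_def nat_le_iff)
    with V2 bit_length_le[of "fst s r"]
    have "\<bar>fst s r\<bar> \<le> int (V ^ 2)" and "bit_length (fst s r) \<le> V ^ 2"
      by linarith+
    then show ?case
      by (simp only: expr_val.simps expr_cost.simps expr_degree.simps)
  next
    case (Mem e)
    let ?x = "expr_val s (Mem e)"
    have "nat \<bar>?x\<bar> \<le> V"
      using s by (simp add: bounded_state_def nat_le_iff)
    moreover have "V ^ 2 + V ^ expr_degree e \<le> V ^ (expr_degree e + 2)"
    proof -
      have "V ^ 2 \<le> V ^ expr_degree e"
        using V expr_degree_ge_2[of e] by (intro power_increasing) auto
      moreover have "2 * V ^ expr_degree e \<le> V ^ 2 * V ^ expr_degree e"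
        using V V2 by (intro mult_right_mono) auto
      moreover have "V ^ (expr_degree e + 2) = V ^ 2 * V ^ expr_degree e"
        by (simp only: power_add mult.commute)
      ultimately show ?thesis by linarith
    qed
    moreover note V2 bit_length_le[of ?x] Mem
    ultimately have "\<bar>?x\<bar> \<le> int (V ^ (expr_degree e + 2))"
      and "bit_length ?x + expr_cost s e \<le> V ^ (expr_degree e + 2)"
      by linarith+
    then show ?case
      by (simp only: expr_cost.simps expr_degree.simps)
  next
    case (Add e f)
    have "nat \<bar>expr_val s (Add e f)\<bar> \<le> V ^ expr_degree e + V ^ expr_degree f"
      unfolding expr_val.simps nat_le_iff of_nat_add using Add by linarith
    moreover note Add bit_length_le[of "expr_val s (Add e f)"]
      power_combination_le(1)[OF V expr_degree_ge_2 expr_degree_ge_2, of e f]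
    ultimately have "\<bar>expr_val s (Add e f)\<bar> \<le> int (V ^ (expr_degree e + expr_degree f + 2))"
      and "bit_length (expr_val s (Add e f)) + expr_cost s e + expr_cost s f
        \<le> V ^ (expr_degree e + expr_degree f + 2)"
      by linarith+
    then show ?case
      by (simp only: expr_cost.simps expr_degree.simps)
  next
    case (Sub e f)
    have "nat \<bar>expr_val s (Sub e f)\<bar> \<le> V ^ expr_degree e + V ^ expr_degree f"
      unfolding expr_val.simps nat_le_iff of_nat_add using Sub by linarith
    moreover note Sub bit_length_le[of "expr_val s (Sub e f)"]
      power_combination_le(1)[OF V expr_degree_ge_2 expr_degree_ge_2, of e f]
    ultimately have "\<bar>expr_val s (Sub e f)\<bar> \<le> int (V ^ (expr_degree e + expr_degree f + 2))"
      and "bit_length (expr_val s (Sub e f)) + expr_cost s e + expr_cost s f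
        \<le> V ^ (expr_degree e + expr_degree f + 2)"
      by linarith+
    then show ?case
      by (simp only: expr_cost.simps expr_degree.simps)
  next
    case (Mul e f)
    have "\<bar>expr_val s e * expr_val s f\<bar> \<le> int (V ^ expr_degree e) * int (V ^ expr_degree f)"
      using Mul by (simp only: abs_mult) (intro mult_mono, auto)
    then have "nat \<bar>expr_val s (Mul e f)\<bar> \<le> V ^ (expr_degree e + expr_degree f)"
      by (simp add: nat_le_iff power_add)
    moreover note Mul bit_length_le[of "expr_val s (Mul e f)"]
      power_combination_le(2)[OF V expr_degree_ge_2 expr_degree_ge_2, of e f]
    ultimately have "\<bar>expr_val s (Mul e f)\<bar> \<le> int (V ^ (expr_degree e + expr_degree f + 2))"
      and "bit_length (expr_val s (Mul e f)) + expr_cost s e + expr_cost s f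
        \<le> V ^ (expr_degree e + expr_degree f + 2)"
      by linarith+
    then show ?case
      by (simp only: expr_cost.simps expr_degree.simps)
  qed
  then show "\<bar>expr_val s e\<bar> \<le> int (V ^ expr_degree e)" and "expr_cost s e \<le> V ^ expr_degree e"
    by auto
qed

text \<open>Programs without loops and queries have a total semantics by recursion, which the simplifier can
  compute; only their running time still refers to \<open>exec\<close>.\<close>

fun straight_line :: "prog \<Rightarrow> bool" where
  "straight_line Skip \<longleftrightarrow> True"
| "straight_line (Assign r e) \<longleftrightarrow> True"
| "straight_line (Store e f) \<longleftrightarrow> True"
| "straight_line (Query r e f) \<longleftrightarrow> False"
| "straight_line (Seq a b) \<longleftrightarrow> straight_line a \<and> straight_line b"
| "straight_line (Branch e a b) \<longleftrightarrow> straight_line a \<and> straight_line b"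
| "straight_line (Loop e a) \<longleftrightarrow> False"

fun run :: "prog \<Rightarrow> state \<Rightarrow> state" where
  "run (Assign r e) s = ((fst s)(r := expr_val s e), snd s)"
| "run (Store e f) s = (fst s, (snd s)(expr_val s e := expr_val s f))"
| "run (Seq a b) s = run b (run a s)"
| "run (Branch e a b) s = (if expr_val s e > 0 then run a s else run b s)"
| "run _ s = s"

fun prog_degree :: "prog \<Rightarrow> nat" where
  "prog_degree (Assign r e) = expr_degree e + 1"
| "prog_degree (Store e f) = expr_degree e + expr_degree f + 2"
| "prog_degree (Seq a b) = prog_degree a + prog_degree a * prog_degree b + 1"
| "prog_degree (Branch e a b) = expr_degree e + prog_degree a + prog_degree b + 2"
| "prog_degree _ = 1"

lemma bounded_state_mono: "bounded_state V s \<Longrightarrow> V \<le> V' \<Longrightarrow> bounded_state V' s"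
  by (force simp: bounded_state_def intro: order_trans)

lemma bounded_state_assign:
  "bounded_state V s \<Longrightarrow> V \<le> V' \<Longrightarrow> \<bar>x\<bar> \<le> int V' \<Longrightarrow> bounded_state V' ((fst s)(r := x), snd s)"
  by (drule (1) bounded_state_mono) (simp add: bounded_state_def)

lemma bounded_state_store:
  "bounded_state V s \<Longrightarrow> V \<le> V' \<Longrightarrow> \<bar>x\<bar> \<le> int V' \<Longrightarrow> bounded_state V' (fst s, (snd s)(a := x))"
  by (drule (1) bounded_state_mono) (simp add: bounded_state_def)

lemma prog_degree_ge_1: "1 \<le> prog_degree c"
  by (induction c) auto

text \<open>The second half of a sequence starts from values bounded by \<open>V ^ prog_degree a\<close> instead of \<open>V\<close>, hence
  the product of degrees.\<close>

lemma exec_straight_line: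
  assumes "straight_line c" and "bounded_state V s" and "2 \<le> V"
  shows "bounded_state (V ^ prog_degree c) (run c s)"
    and "\<exists>t. exec d orc c s t 0 (run c s) \<and> t \<le> V ^ prog_degree c"
proof -
  have "bounded_state (V ^ prog_degree c) (run c s) \<and>
      (\<exists>t. exec d orc c s t 0 (run c s) \<and> t \<le> V ^ prog_degree c)"
    using assms
  proof (induction c arbitrary: V s)
    case Skip
    then show ?case by (auto intro: exec_Skip)
  next
    case (Assign r e)
    have "V ^ expr_degree e + V ^ 0 \<le> V ^ (expr_degree e + 0 + 1)"
      using Assign.prems by (intro power_sum_le)
    then have *: "V ^ expr_degree e + 1 \<le> V ^ (expr_degree e + 1)" by simp
    have "V \<le> V ^ (expr_degree e + 1)"
      using Assign.prems(3) by (intro self_le_power) auto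
    moreover have "\<bar>expr_val s e\<bar> \<le> int (V ^ (expr_degree e + 1))"
      using * expr_bounds(1)[OF Assign.prems(2,3), of e] by linarith
    ultimately have "bounded_state (V ^ prog_degree (Assign r e)) (run (Assign r e) s)"
      unfolding prog_degree.simps run.simps by (intro bounded_state_assign[OF Assign.prems(2)])
    moreover have "1 + expr_cost s e \<le> V ^ prog_degree (Assign r e)"
      unfolding prog_degree.simps using * expr_bounds(2)[OF Assign.prems(2,3), of e] by linarith
    ultimately
    show ?case
      using exec_Assign[of d orc r e s] by (auto simp del: prog_degree.simps)
  next
    case (Store e f)
    have *: "2 * V ^ expr_degree e + 2 * V ^ expr_degree f + 1 \<le> V ^ (expr_degree e + expr_degree f + 2)"
      using Store.prems expr_degree_ge_2 by (intro power_combination_le)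
    have "V \<le> V ^ (expr_degree e + expr_degree f + 2)"
      using Store.prems(3) by (intro self_le_power) auto
    moreover have "\<bar>expr_val s f\<bar> \<le> int (V ^ (expr_degree e + expr_degree f + 2))"
      using * expr_bounds(1)[OF Store.prems(2,3), of f] by linarith
    ultimately have "bounded_state (V ^ prog_degree (Store e f)) (run (Store e f) s)"
      unfolding prog_degree.simps run.simps by (intro bounded_state_store[OF Store.prems(2)])
    moreover have "1 + expr_cost s e + expr_cost s f \<le> V ^ prog_degree (Store e f)"
      unfolding prog_degree.simps
      using * expr_bounds(2)[OF Store.prems(2,3), of e] expr_bounds(2)[OF Store.prems(2,3), of f]
      by linarith
    ultimately
    show ?case
      using exec_Store[of d orc e f s] by (auto simp del: prog_degree.simps)
  next
    case (Seq a b)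
    from Seq.IH(1)[of V s] Seq.prems obtain t
      where bd: "bounded_state (V ^ prog_degree a) (run a s)"
        and a: "exec d orc a s t 0 (run a s)" "t \<le> V ^ prog_degree a" by auto
    have V: "2 \<le> V ^ prog_degree a"
      using Seq.prems(3) power_increasing[of 1 "prog_degree a" V] prog_degree_ge_1[of a] by simp
    from Seq.IH(2)[OF _ bd V] Seq.prems obtain t'
      where bd': "bounded_state ((V ^ prog_degree a) ^ prog_degree b) (run b (run a s))"
        and b: "exec d orc b (run a s) t' 0 (run b (run a s))" "t' \<le> (V ^ prog_degree a) ^ prog_degree b"
      by auto
    have *: "V ^ prog_degree a + (V ^ prog_degree a) ^ prog_degree b \<le> V ^ prog_degree (Seq a b)"
      using power_sum_le[OF Seq.prems(3), of "prog_degree a" "prog_degree a * prog_degree b"]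
      by (simp add: power_mult)
    have "bounded_state (V ^ prog_degree (Seq a b)) (run (Seq a b) s)"
      using bd' * by (auto intro: bounded_state_mono simp del: prog_degree.simps)
    moreover have "exec d orc (Seq a b) s (t + t') 0 (run (Seq a b) s)"
      using exec_Seq[OF a(1) b(1)] by simp
    ultimately show ?case
      using * a(2) b(2) by (meson add_mono order_trans)
  next
    case (Branch e a b)
    define c where "c = (if expr_val s e > 0 then a else b)"
    have run: "run (Branch e a b) s = run c s"
      by (simp add: c_def)
    have "bounded_state (V ^ prog_degree c) (run c s) \<and>
        (\<exists>t. exec d orc c s t 0 (run c s) \<and> t \<le> V ^ prog_degree c)"
      using Branch by (simp add: c_def)
    then obtain t where bd: "bounded_state (V ^ prog_degree c) (run c s)"
      and t: "exec d orc c s t 0 (run c s)" "t \<le> V ^ prog_degree c" by blast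
    have c: "prog_degree c \<le> prog_degree a + prog_degree b"
      by (simp add: c_def)
    have "V ^ prog_degree c \<le> V ^ (prog_degree a + prog_degree b)"
      using Branch.prems(3) c by (intro power_increasing) auto
    moreover have "V ^ expr_degree e + V ^ (prog_degree a + prog_degree b)
        \<le> V ^ (expr_degree e + prog_degree a + prog_degree b + 1)"
      using power_sum_le[OF Branch.prems(3), of "expr_degree e" "prog_degree a + prog_degree b"] by (simp add: ac_simps)
    moreover have "V ^ (expr_degree e + prog_degree a + prog_degree b + 1) + V ^ 0
        \<le> V ^ (expr_degree e + prog_degree a + prog_degree b + 1 + 0 + 1)"
      using Branch.prems(3) by (rule power_sum_le)
    ultimately have *: "1 + V ^ expr_degree e + V ^ prog_degree c \<le> V ^ prog_degree (Branch e a b)"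
      by (simp add: ac_simps)
    have "bounded_state (V ^ prog_degree (Branch e a b)) (run (Branch e a b) s)"
      unfolding run using bd by (rule bounded_state_mono) (use * in linarith)
    moreover have "exec d orc (Branch e a b) s (1 + expr_cost s e + t) 0 (run (Branch e a b) s)"
      unfolding run using t(1) by (intro exec_Branch) (simp add: c_def)
    moreover have "1 + expr_cost s e + t \<le> V ^ prog_degree (Branch e a b)"
      using * t(2) expr_bounds(2)[OF Branch.prems(2,3), of e] by linarith
    ultimately show ?case by blast
  qed auto
  then show "bounded_state (V ^ prog_degree c) (run c s)"
    and "\<exists>t. exec d orc c s t 0 (run c s) \<and> t \<le> V ^ prog_degree c" by auto
qed

text \<open>A Hoare triple for total correctness. The bound on the running time is recorded by its exponent
  \<open>k\<close>, so that composing programs amounts to adding up exponents that do not depend on the input.\<close>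

definition timed_triple ::
    "nat \<Rightarrow> oracle_fun \<Rightarrow> nat \<Rightarrow> (state \<Rightarrow> bool) \<Rightarrow> prog \<Rightarrow> nat \<Rightarrow> (state \<Rightarrow> bool) \<Rightarrow> bool" where
  "timed_triple d orc V P c k Q \<longleftrightarrow>
     (\<forall>s. P s \<longrightarrow> (\<exists>t s'. exec d orc c s t 0 s' \<and> t \<le> V ^ k \<and> Q s'))"

lemma timed_triple_straight_line:
  assumes "straight_line c" and "2 \<le> V"
    and "\<And>s. P s \<Longrightarrow> bounded_state V s" and "\<And>s. P s \<Longrightarrow> Q (run c s)"
  shows "timed_triple d orc V P c (prog_degree c) Q"
  unfolding timed_triple_def using assms exec_straight_line(2) by blast

lemma timed_triple_Seq:
  assumes "timed_triple d orc V P a k R" and "timed_triple d orc V R b l Q" and "2 \<le> V"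
  shows "timed_triple d orc V P (Seq a b) (k + l + 1) Q"
  unfolding timed_triple_def
proof (intro allI impI)
  fix s assume "P s"
  with assms(1) obtain t s' where a: "exec d orc a s t 0 s'" "t \<le> V ^ k" "R s'"
    unfolding timed_triple_def by blast
  with assms(2) obtain t' s'' where b: "exec d orc b s' t' 0 s''" "t' \<le> V ^ l" "Q s''"
    unfolding timed_triple_def by blast
  have "exec d orc (Seq a b) s (t + t') 0 s''"
    using exec_Seq[OF a(1) b(1)] by simp
  moreover have "t + t' \<le> V ^ (k + l + 1)"
    using a(2) b(2) power_sum_le[OF assms(3), of k l] by linarith
  ultimately show "\<exists>t s'. exec d orc (Seq a b) s t 0 s' \<and> t \<le> V ^ (k + l + 1) \<and> Q s'"
    using b(3) by blast
qed

text \<open>The invariant carries a variant \<open>i\<close> that starts at \<open>N\<close> and decreases in every iteration. It may mention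
  values that are not part of the state, which a measure on states could not. That the invariant
  enforces the bound \<open>V\<close> at every loop head keeps values from growing with the number of iterations.
  The at most \<open>N + 1 \<le> V\<^sup>2\<close> evaluations of the guard raise the exponent by \<open>2\<close>.\<close>

lemma timed_triple_Loop:
  assumes V: "2 \<le> V" and N: "N < V\<^sup>2"
    and bounded: "\<And>i s. I i s \<Longrightarrow> bounded_state V s"
    and body: "\<And>i. timed_triple d orc V (\<lambda>s. I i s \<and> expr_val s e > 0) c k (\<lambda>s. \<exists>i'<i. I i' s)"
  shows "timed_triple d orc V (I N) (Loop e c) (expr_degree e + k + 4)
    (\<lambda>s. (\<exists>i. I i s) \<and> \<not> expr_val s e > 0)"
proof -
  let ?T = "1 + V ^ expr_degree e + V ^ k"
  have *: "\<exists>t s'. exec d orc (Loop e c) s t 0 s' \<and> t \<le> (i + 1) * ?T \<and>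
      (\<exists>i. I i s') \<and> \<not> expr_val s' e > 0" if "I i s" for i s
    using that
  proof (induction i arbitrary: s rule: less_induct)
    case (less i)
    have g: "expr_cost s e \<le> V ^ expr_degree e"
      using bounded[OF less.prems] V by (rule expr_bounds)
    show ?case
    proof (cases "expr_val s e > 0")
      case True
      with body less.prems obtain t s' i' where a: "exec d orc c s t 0 s'" "t \<le> V ^ k" "i' < i" "I i' s'"
        unfolding timed_triple_def by metis
      with less.IH obtain t' s'' where b: "exec d orc (Loop e c) s' t' 0 s''" "t' \<le> (i' + 1) * ?T"
        "\<exists>i. I i s''" "\<not> expr_val s'' e > 0"
        by blast
      have "(i' + 1) * ?T \<le> i * ?T"
        using a(3) by (intro mult_right_mono) auto
      then have "1 + expr_cost s e + t + t' \<le> ?T + i * ?T"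
        using a(2) b(2) g by linarith
      then have "1 + expr_cost s e + t + t' \<le> (i + 1) * ?T"
        by simp
      moreover have "exec d orc (Loop e c) s (1 + expr_cost s e + t + t') 0 s''"
        using exec_Loop_True[OF True a(1) b(1)] by simp
      ultimately show ?thesis using b(3,4) by blast
    next
      case False
      have "1 + expr_cost s e \<le> (i + 1) * ?T"
        using g by (simp add: trans_le_add1)
      with exec_Loop_False[OF False] False less.prems show ?thesis by blast
    qed
  qed
  have "?T \<le> V ^ (expr_degree e + k + 2)"
  proof -
    have "V ^ expr_degree e + V ^ k \<le> V ^ (expr_degree e + k + 1)"
      using V by (rule power_sum_le)
    moreover have "V ^ (expr_degree e + k + 1) + V ^ 0 \<le> V ^ (expr_degree e + k + 1 + 0 + 1)"
      using V by (rule power_sum_le)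
    ultimately show ?thesis by simp
  qed
  then have "(N + 1) * ?T \<le> V\<^sup>2 * V ^ (expr_degree e + k + 2)"
    using N by (intro mult_mono) auto
  also have "\<dots> = V ^ (2 + (expr_degree e + k + 2))"
    by (simp only: power_add)
  also have "2 + (expr_degree e + k + 2) = expr_degree e + k + 4" by simp
  finally show ?thesis
    using * unfolding timed_triple_def by (meson order_trans)
qed

section \<open>The auction as a program\<close>

text \<open>Register \<open>1\<close> holds the current bidder, register \<open>2\<close> the number \<open>m\<close> of bidders that have entered;
  registers \<open>3\<close>, \<open>4\<close> and \<open>5\<close> hold the object under inspection, the cheapest object found so far and
  its total expense.\<close>

abbreviation "rN \<equiv> Reg 0"
abbreviation "rBidder \<equiv> Reg 1"
abbreviation "rIntroduced \<equiv> Reg 2"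
abbreviation "rJ \<equiv> Reg 3"
abbreviation "rBest \<equiv> Reg 4"
abbreviation "rLow \<equiv> Reg 5"
abbreviation "rTmp \<equiv> Reg 6"

text \<open>The input, and later the output, occupy cells with nonnegative addresses. Price and owner of object \<open>j\<close>
  are kept at \<open>-2 j\<close> and \<open>-2 j - 1\<close>. These cells are initially \<open>0\<close>, as the auction requires.\<close>

abbreviation price_cell :: "expr \<Rightarrow> expr" where
  "price_cell e \<equiv> Mul (Num (-2)) e"

abbreviation owner_cell :: "expr \<Rightarrow> expr" where
  "owner_cell e \<equiv> Sub (Mul (Num (-2)) e) (Num 1)"

text \<open>Since \<open>d\<close> is fixed, the \<open>d\<close> weights of an edge are summed by a single expression.\<close>

fun weight_sum_expr :: "nat \<Rightarrow> expr" where
  "weight_sum_expr 0 = Num 0"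
| "weight_sum_expr (Suc k) = Add (weight_sum_expr k)
     (Mem (Add (Mul (Add (Mul (Num (int k)) rN) (Sub rBidder (Num 1))) rN) rJ))"

definition offer_expr :: "nat \<Rightarrow> expr" where
  "offer_expr d = Add (Mul (Add rN (Num 1)) (weight_sum_expr d)) (Mem (price_cell rJ))"

definition setup_prog :: prog where
  "setup_prog = Seq (Assign 0 (Mem (Num 0))) (Seq (Assign 1 (Num 1)) (Assign 2 (Num 1)))"

text \<open>The bidder scans the objects from \<open>n\<close> down to \<open>1\<close>; object \<open>n\<close> provides the first candidate and is
  inspected a second time by the loop, to no effect.\<close>

definition first_offer_prog :: "nat \<Rightarrow> prog" where
  "first_offer_prog d = Seq (Assign 3 rN) (Seq (Assign 4 rJ) (Assign 5 (offer_expr d)))"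

definition next_offer_prog :: "nat \<Rightarrow> prog" where
  "next_offer_prog d = Seq (Assign 6 (offer_expr d))
     (Seq (Branch (Sub rLow rTmp) (Seq (Assign 4 rJ) (Assign 5 rTmp)) Skip)
       (Assign 3 (Sub rJ (Num 1))))"

definition award_prog :: prog where
  "award_prog = Seq (Assign 6 (Mem (owner_cell rBest)))
     (Seq (Store (owner_cell rBest) rBidder)
     (Seq (Store (price_cell rBest) (Add (Mem (price_cell rBest)) (Num 1)))
       (Branch rTmp (Assign 1 rTmp)
         (Seq (Assign 2 (Add rIntroduced (Num 1))) (Assign 1 rIntroduced)))))"

definition auction_prog :: "nat \<Rightarrow> prog" where
  "auction_prog d = Loop (Sub (Add rN (Num 1)) rBidder)
     (Seq (first_offer_prog d) (Seq (Loop rJ (next_offer_prog d)) award_prog))"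

text \<open>The output overwrites cells \<open>1, \<dots>, n\<close>, which hold weights, and so has to wait until the auction is over.\<close>

definition output_prog :: prog where
  "output_prog = Seq (Assign 3 rN)
     (Loop rJ (Seq (Store (Mem (owner_cell rJ)) rJ) (Assign 3 (Sub rJ (Num 1)))))"

definition matching_prog :: "nat \<Rightarrow> prog" where
  "matching_prog d = Seq setup_prog (Seq (auction_prog d) output_prog)"

text \<open>These exponents follow the structure of the program, as prescribed by the rules for sequences and loops.
  They depend on \<open>d\<close> alone.\<close>

definition scan_degree :: "nat \<Rightarrow> nat" where
  "scan_degree d = expr_degree rJ + prog_degree (next_offer_prog d) + 4"

definition round_degree :: "nat \<Rightarrow> nat" where
  "round_degree d = prog_degree (first_offer_prog d) + (scan_degree d + prog_degree award_prog + 1) + 1"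

definition auction_degree :: "nat \<Rightarrow> nat" where
  "auction_degree d = expr_degree (Sub (Add rN (Num 1)) rBidder) + round_degree d + 4"

definition output_degree :: nat where
  "output_degree = prog_degree (Assign 3 rN) + (expr_degree rJ +
     prog_degree (Seq (Store (Mem (owner_cell rJ)) rJ) (Assign 3 (Sub rJ (Num 1)))) + 4) + 1"

definition matching_degree :: "nat \<Rightarrow> nat" where
  "matching_degree d = prog_degree setup_prog + (auction_degree d + output_degree + 1) + 1"

definition total_weight :: "nat \<Rightarrow> (nat \<Rightarrow> nat \<Rightarrow> nat \<Rightarrow> nat) \<Rightarrow> nat \<Rightarrow> nat \<Rightarrow> nat" where
  "total_weight d w i j = (\<Sum>k<d. w (k + 1) i j)"

lemma nth_concat_map:
  assumes "\<And>x. x \<in> set xs \<Longrightarrow> length (f x) = l" and "k < length xs" and "r < l"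
  shows "concat (map f xs) ! (k * l + r) = f (xs ! k) ! r"
  using assms
proof (induction xs arbitrary: k)
  case (Cons x xs)
  have len: "length (f x) = l"
    using Cons.prems(1) by simp
  show ?case
  proof (cases k)
    case 0
    then show ?thesis
      using Cons.prems(3) len by (simp add: nth_append)
  next
    case (Suc k')
    have "concat (map f (x # xs)) ! (length (f x) + (k' * l + r)) = concat (map f xs) ! (k' * l + r)"
      by (simp only: list.map concat.simps nth_append_length_plus)
    also have "\<dots> = f (xs ! k') ! r"
      by (rule Cons.IH) (use Cons.prems Suc in simp_all)
    finally show ?thesis
      unfolding Suc len by (simp only: mult_Suc add.assoc nth_Cons_Suc)
  qed
qed simp

lemma length_concat_map:
  assumes "\<And>x. x \<in> set xs \<Longrightarrow> length (f x) = l"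
  shows "length (concat (map f xs)) = length xs * l"
  using assms by (induction xs) auto

definition input_cell :: "nat \<Rightarrow> nat \<Rightarrow> nat \<Rightarrow> nat \<Rightarrow> int" where
  "input_cell n k i j = (int k * int n + (int i - 1)) * int n + int j"

lemma input_cell_eq:
  assumes "i \<in> {1..n}"
  shows "input_cell n k i j = int ((k * n + (i - 1)) * n + j)"
proof -
  have "int i - 1 = int (i - 1)" using assms by auto
  then show ?thesis
    by (simp only: input_cell_def of_nat_add of_nat_mult)
qed

lemma input_cell_pos: "i \<in> {1..n} \<Longrightarrow> j \<in> {1..n} \<Longrightarrow> 0 < input_cell n k i j"
  by (simp only: input_cell_eq of_nat_0_less_iff) simp

lemma length_input_list: "length (input_list d n w) = d * (n * n) + 1"
  by (simp add: input_list_def length_concat_map[where l = "n * n"] length_concat_map[where l = n])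

lemma input_list_nth:
  assumes "k < d" and "i \<in> {1..n}" and "j \<in> {1..n}"
  shows "(k * n + (i - 1)) * n + j < length (input_list d n w)"
    and "input_list d n w ! ((k * n + (i - 1)) * n + j) = int (w (k + 1) i j)"
proof -
  have r: "(i - 1) * n + (j - 1) < n * n"
  proof -
    have "(i - 1) * n + (j - 1) < (i - 1) * n + n" using assms(3) by auto
    also have "\<dots> = (i - 1 + 1) * n" by simp
    also have "\<dots> \<le> n * n" using assms(2) by (intro mult_right_mono) auto
    finally show ?thesis .
  qed
  have eq: "(k * n + (i - 1)) * n + j = Suc (k * (n * n) + ((i - 1) * n + (j - 1)))"
    using assms(3) by (simp add: algebra_simps)
  have "k * (n * n) + n * n = (k + 1) * (n * n)" by simp
  also have "\<dots> \<le> d * (n * n)" using assms(1) by (intro mult_right_mono) auto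
  finally show "(k * n + (i - 1)) * n + j < length (input_list d n w)"
    using r unfolding eq length_input_list by linarith
  let ?row = "\<lambda>k i. map (\<lambda>j. int (w k i j)) [1..<n + 1]"
  have "input_list d n w ! ((k * n + (i - 1)) * n + j)
      = concat (map (\<lambda>k. concat (map (?row k) [1..<n + 1])) [1..<d + 1])
          ! (k * (n * n) + ((i - 1) * n + (j - 1)))"
    unfolding eq by (simp add: input_list_def)
  also have "\<dots> = concat (map (?row (k + 1)) [1..<n + 1]) ! ((i - 1) * n + (j - 1))"
    using assms(1) r
    by (subst nth_concat_map) (auto simp: length_concat_map[where l = n] simp del: upt_Suc)
  also have "\<dots> = ?row (k + 1) i ! (j - 1)"
    using assms(2,3) by (subst nth_concat_map) (auto simp del: upt_Suc)
  finally show "input_list d n w ! ((k * n + (i - 1)) * n + j) = int (w (k + 1) i j)"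
    using assms(3) by (auto simp del: upt_Suc)
qed

lemma set_input_list:
  "set (input_list d n w) \<subseteq> insert (int n) {int (w (k + 1) i j) | k i j. k < d \<and> i \<in> {1..n} \<and> j \<in> {1..n}}"
proof -
  have "\<exists>k' i' j'. int (w k i j) = int (w (k' + 1) i' j') \<and> k' < d \<and> i' \<in> {1..n} \<and> j' \<in> {1..n}"
    if "k \<in> {1..<d + 1}" "i \<in> {1..<n + 1}" "j \<in> {1..<n + 1}" for k i j
    using that by (intro exI[of _ "k - 1"] exI[of _ i] exI[of _ j]) auto
  then show ?thesis
    by (fastforce simp: input_list_def)
qed

text \<open>The bound \<open>V\<close> leaves room for bidder \<open>n + 1\<close>, for prices up to \<open>B + 1\<close> and for offers
  \<open>c i j + price j \<le> 2 * B + 1\<close>.\<close>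

locale auction_input =
  fixes d :: nat and orc :: oracle_fun and n :: nat and w :: "nat \<Rightarrow> nat \<Rightarrow> nat \<Rightarrow> nat"
    and B V :: nat
  assumes n: "1 \<le> n"
    and cost_le: "\<And>i j. i \<in> {1..n} \<Longrightarrow> j \<in> {1..n} \<Longrightarrow> (n + 1) * total_weight d w i j \<le> B"
    and V_ge: "2 * B + n + 2 \<le> V"
begin

abbreviation cost :: "nat \<Rightarrow> nat \<Rightarrow> nat" where
  "cost i j \<equiv> (n + 1) * total_weight d w i j"

abbreviation triple :: "(state \<Rightarrow> bool) \<Rightarrow> prog \<Rightarrow> nat \<Rightarrow> (state \<Rightarrow> bool) \<Rightarrow> bool" where
  "triple \<equiv> timed_triple d orc V"

lemma V_ge_2: "2 \<le> V"
  using V_ge by simp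

lemma weight_le:
  assumes "k < d" and "i \<in> {1..n}" and "j \<in> {1..n}"
  shows "w (k + 1) i j \<le> B"
proof -
  have "w (k + 1) i j \<le> total_weight d w i j"
    unfolding total_weight_def using assms(1) by (intro member_le_sum) auto
  also have "\<dots> \<le> cost i j" by simp
  finally show ?thesis using cost_le[OF assms(2,3)] by simp
qed

definition represents ::
    "(nat \<Rightarrow> nat) \<Rightarrow> (nat \<Rightarrow> nat) \<Rightarrow> nat \<Rightarrow> nat \<Rightarrow> state \<Rightarrow> bool" where
  "represents price owner bidder m s \<longleftrightarrow>
     fst s 0 = int n \<and> fst s 1 = int bidder \<and> fst s 2 = int m \<and>
     (\<forall>j\<in>{1..n}. snd s (-2 * int j) = int (price j) \<and> snd s (-2 * int j - 1) = int (owner j)) \<and>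
     (\<forall>k<d. \<forall>i\<in>{1..n}. \<forall>j\<in>{1..n}.
        snd s (input_cell n k i j) = int (w (k + 1) i j)) \<and>
     bounded_state V s"

lemma offer_expr_val:
  assumes s: "represents price owner bidder m s" and "fst s 3 = int j"
    and ij: "bidder \<in> {1..n}" "j \<in> {1..n}"
  shows "expr_val s (offer_expr d) = int (cost bidder j + price j)"
proof -
  have "expr_val s (weight_sum_expr k) = int (\<Sum>k<k. w (k + 1) bidder j)" if "k \<le> d" for k
    using that
  proof (induction k)
    case (Suc k)
    have "snd s (input_cell n k bidder j) = int (w (k + 1) bidder j)"
      using Suc.prems s ij by (simp add: represents_def)
    then show ?case
      using Suc s assms(2) by (simp add: represents_def input_cell_def)
  qed simp
  then show ?thesis
    using s assms(2) ij by (simp add: offer_expr_def represents_def total_weight_def distrib_right)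
qed

definition auction_state :: "nat \<Rightarrow> state \<Rightarrow> bool" where
  "auction_state i s \<longleftrightarrow> (\<exists>price owner bidder m. auction_inv n cost B price owner bidder m \<and>
     represents price owner bidder m s \<and> remaining_raises n B price = i)"

text \<open>Invariant of the scan: objects above \<open>i\<close> have been inspected, and none of them is cheaper than
  the candidate \<open>b\<close>.\<close>

definition scan_state ::
    "(nat \<Rightarrow> nat) \<Rightarrow> (nat \<Rightarrow> nat) \<Rightarrow> nat \<Rightarrow> nat \<Rightarrow> nat \<Rightarrow> state \<Rightarrow> bool" where
  "scan_state price owner bidder m i s \<longleftrightarrow>
     represents price owner bidder m s \<and> fst s 3 = int i \<and> i \<le> n \<and>
     (\<exists>b\<in>{1..n}. fst s 4 = int b \<and> fst s 5 = int (cost bidder b + price b) \<and>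
        (\<forall>j\<in>{i + 1..n}. cost bidder b + price b \<le> cost bidder j + price j))"

lemma setup_triple:
  "triple (\<lambda>s. s = initial_state (input_list d n w)) setup_prog (prog_degree setup_prog)
     (auction_state (n * (B + 1)))"
proof (rule timed_triple_straight_line[OF _ V_ge_2])
  fix s assume s: "s = initial_state (input_list d n w)"
  have "\<bar>x\<bar> \<le> int V" if "x \<in> set (input_list d n w)" for x
  proof -
    from that set_input_list consider "x = int n"
      | k i j where "x = int (w (k + 1) i j)" "k < d" "i \<in> {1..n}" "j \<in> {1..n}"
      by blast
    then show ?thesis
    proof cases
      case 2
      with weight_le[of k i j] V_ge show ?thesis by linarith
    qed (use V_ge in simp)
  qed
  then show bd: "bounded_state V s"
    unfolding s bounded_state_def initial_state_def by (auto simp: nat_less_iff)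
  have mem: "snd s 0 = int n"
    unfolding s initial_state_def by (simp add: input_list_def)
  have "represents (\<lambda>_. 0) (\<lambda>_. 0) 1 1 (run setup_prog s)"
    using bd mem input_list_nth[of _ d _ n _ w] V_ge unfolding represents_def setup_prog_def
    by (auto simp: bounded_state_def s initial_state_def input_cell_eq nat_int simp del: of_nat_add of_nat_mult)
  then show "auction_state (n * (B + 1)) (run setup_prog s)"
    unfolding auction_state_def using auction_inv_init[OF n]
    by (intro exI[of _ "\<lambda>_. 0"] exI[of _ 1]) (auto simp: remaining_raises_def)
qed (simp add: setup_prog_def)

lemma offer_le_V:
  assumes "auction_inv n cost B price owner bidder m" and "bidder \<le> n" and "j \<in> {1..n}"
  shows "cost bidder j + price j \<le> V"
proof -
  have "bidder \<in> {1..n}" "price j \<le> B + 1"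
    using assms by (auto simp: auction_inv_def)
  with cost_le[of bidder j] assms(3) show ?thesis
    using V_ge by linarith
qed

lemma first_offer_triple:
  assumes inv: "auction_inv n cost B price owner bidder m" "bidder \<le> n"
  shows "triple (represents price owner bidder m) (first_offer_prog d) (prog_degree (first_offer_prog d))
     (scan_state price owner bidder m n)"
proof (rule timed_triple_straight_line[OF _ V_ge_2])
  fix s assume s: "represents price owner bidder m s"
  then show "bounded_state V s" by (simp add: represents_def)
  have ij: "bidder \<in> {1..n}" "n \<in> {1..n}"
    using inv n by (auto simp: auction_inv_def)
  \<comment> \<open>The offer is evaluated after registers \<open>3\<close> and \<open>4\<close> have been set.\<close>
  define s' where "s' = ((fst s)(3 := int n, 4 := int n), snd s)"
  have s': "represents price owner bidder m s'"
    using s V_ge by (auto simp: represents_def s'_def bounded_state_def)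
  define x where "x = cost bidder n + price n"
  have "expr_val s' (offer_expr d) = int x"
    unfolding x_def using s' ij by (intro offer_expr_val) (auto simp: s'_def)
  then have run: "run (first_offer_prog d) s = ((fst s')(5 := int x), snd s')"
    using s by (simp add: first_offer_prog_def represents_def s'_def)
  have "x \<le> V"
    unfolding x_def by (rule offer_le_V[OF inv ij(2)])
  with s' have "represents price owner bidder m (run (first_offer_prog d) s)"
    unfolding run by (auto simp: represents_def bounded_state_def)
  moreover have "fst (run (first_offer_prog d) s) 5 = int (cost bidder n + price n)"
    unfolding run x_def by (simp only: fst_conv fun_upd_same)
  moreover have "fst (run (first_offer_prog d) s) 3 = int n" "fst (run (first_offer_prog d) s) 4 = int n"
    unfolding run s'_def by simp_all
  ultimately show "scan_state price owner bidder m n (run (first_offer_prog d) s)"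
    unfolding scan_state_def using ij(2) by (intro conjI bexI[of _ n]) auto
qed (simp add: first_offer_prog_def)

lemma next_offer_triple:
  assumes inv: "auction_inv n cost B price owner bidder m" "bidder \<le> n"
  shows "triple (\<lambda>s. scan_state price owner bidder m i s \<and> expr_val s rJ > 0)
     (next_offer_prog d) (prog_degree (next_offer_prog d))
     (\<lambda>s. \<exists>i'<i. scan_state price owner bidder m i' s)"
proof (rule timed_triple_straight_line[OF _ V_ge_2])
  fix s assume "scan_state price owner bidder m i s \<and> expr_val s rJ > 0"
  then obtain b where s: "represents price owner bidder m s" and J: "fst s 3 = int i"
    and i: "i \<in> {1..n}" and b: "b \<in> {1..n}" "fst s 4 = int b"
    and low: "fst s 5 = int (cost bidder b + price b)"
    and best: "\<forall>j\<in>{i + 1..n}. cost bidder b + price b \<le> cost bidder j + price j"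
    by (auto simp: scan_state_def)
  from s show "bounded_state V s" by (simp add: represents_def)
  have bidder: "bidder \<in> {1..n}"
    using inv by (auto simp: auction_inv_def)
  define x where "x = cost bidder i + price i"
  define y where "y = cost bidder b + price b"
  have xy: "x \<le> V" "y \<le> V"
    unfolding x_def y_def using offer_le_V[OF inv] i b by auto
  have val: "expr_val s (offer_expr d) = int x"
    unfolding x_def using s J bidder i by (rule offer_expr_val)
  have low': "fst s 5 = int y"
    using low by (simp only: y_def)
  define b' where "b' = (if x < y then i else b)"
  define y' where "y' = (if x < y then x else y)"
  have run: "run (next_offer_prog d) s
      = ((fst s)(6 := int x, 4 := int b', 5 := int y', 3 := int (i - 1)), snd s)"
    using val J b low' i by (auto simp: next_offer_prog_def b'_def y'_def of_nat_diff fun_eq_iff)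
  have "represents price owner bidder m (run (next_offer_prog d) s)"
    unfolding run using s xy b(1) i V_ge
    by (auto simp: represents_def bounded_state_def b'_def y'_def)
  moreover have "y' = cost bidder b' + price b'" "b' \<in> {1..n}"
    using b i by (auto simp: b'_def y'_def x_def y_def)
  moreover have "y' \<le> cost bidder j + price j" if "j \<in> {i..n}" for j
  proof (cases "j = i")
    case False
    with that best have "y \<le> cost bidder j + price j" by (auto simp: y_def)
    then show ?thesis by (auto simp: y'_def)
  qed (auto simp: y'_def x_def)
  ultimately have "scan_state price owner bidder m (i - 1) (run (next_offer_prog d) s)"
    using i unfolding scan_state_def run by auto
  with i show "\<exists>i'<i. scan_state price owner bidder m i' (run (next_offer_prog d) s)"
    by (intro exI[of _ "i - 1"]) auto
qed (simp add: next_offer_prog_def)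

lemma award_triple:
  assumes inv: "auction_inv n cost B price owner bidder m" "bidder \<le> n"
  shows "triple (\<lambda>s. (\<exists>i. scan_state price owner bidder m i s) \<and> \<not> expr_val s rJ > 0)
     award_prog (prog_degree award_prog)
     (\<lambda>s. \<exists>i<remaining_raises n B price. auction_state i s)"
proof (rule timed_triple_straight_line[OF _ V_ge_2])
  fix s assume "(\<exists>i. scan_state price owner bidder m i s) \<and> \<not> expr_val s rJ > 0"
  then obtain b where s: "represents price owner bidder m s"
    and b: "b \<in> {1..n}" "fst s 4 = int b"
    and best: "\<And>j. j \<in> {1..n} \<Longrightarrow> cost bidder b + price b \<le> cost bidder j + price j"
    by (auto simp: scan_state_def)
  from s show "bounded_state V s" by (simp add: represents_def)
  define price' where "price' = price(b := price b + 1)"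
  define owner' where "owner' = owner(b := bidder)"
  define bidder' where "bidder' = (if owner b > 0 then owner b else m + 1)"
  define m' where "m' = (if owner b > 0 then m else m + 1)"
  note step = auction_step[OF inv cost_le b(1) best price'_def owner'_def bidder'_def m'_def]
  have le: "price' b \<le> B + 1" "bidder' \<le> n + 1" "m' \<le> n + 1" 
    using step(1) b(1) by (auto simp: auction_inv_def)
  have run: "run award_prog s
      = ((fst s)(6 := int (owner b), 2 := int m', 1 := int bidder'),
         (snd s)(-2 * int b - 1 := int bidder, -2 * int b := int (price' b)))"
    using s b by (auto simp: award_prog_def represents_def bidder'_def m'_def price'_def fun_eq_iff)
  \<comment> \<open>Cells of prices have even, cells of owners odd addresses.\<close>
  have par: "- (2 * int j) \<noteq> - (2 * int j') - 1" for j j'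
    by presburger
  have "represents price' owner' bidder' m' (run award_prog s)"
    unfolding run represents_def
  proof (intro conjI ballI allI impI)
    fix k i j assume "k < d" "i \<in> {1..n}" "j \<in> {1..n}"
    then show "snd ((fst s)(6 := int (owner b), 2 := int m', 1 := int bidder'),
         (snd s)(-2 * int b - 1 := int bidder, -2 * int b := int (price' b)))
       (input_cell n k i j) = int (w (k + 1) i j)"
      using s b(1) input_cell_pos[of i n j k] by (simp add: represents_def)
  next
    have "owner b \<le> V"
      using s b(1) unfolding represents_def bounded_state_def
      by (metis abs_of_nat of_nat_le_iff)
    then show "bounded_state V ((fst s)(6 := int (owner b), 2 := int m', 1 := int bidder'),
         (snd s)(-2 * int b - 1 := int bidder, -2 * int b := int (price' b)))"
      using s le inv(2) V_ge by (auto simp: represents_def bounded_state_def)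
  qed (use s b par in \<open>auto simp: represents_def price'_def owner'_def\<close>)
  with step show "\<exists>i<remaining_raises n B price. auction_state i (run award_prog s)"
    unfolding auction_state_def by blast
qed (simp add: award_prog_def)

lemma n_less: "n < V\<^sup>2" and raises_less: "n * (B + 1) < V\<^sup>2"
proof -
  have "n < V" "B + 1 \<le> V" "0 < V" using V_ge by auto
  then have "n * (B + 1) \<le> n * V" "n * V < V * V"
    by (auto intro: mult_left_mono simp del: mult_Suc_right)
  then show "n * (B + 1) < V\<^sup>2" unfolding power2_eq_square by linarith
  moreover have "n \<le> n * (B + 1)" by simp
  ultimately show "n < V\<^sup>2" by linarith
qed


lemma scan_loop_triple:
  assumes "auction_inv n cost B price owner bidder m" and "bidder \<le> n"
  shows "triple (scan_state price owner bidder m n) (Loop rJ (next_offer_prog d)) (scan_degree d)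
     (\<lambda>s. (\<exists>i. scan_state price owner bidder m i s) \<and> \<not> expr_val s rJ > 0)"
  unfolding scan_degree_def using V_ge_2 n_less _ next_offer_triple[OF assms]
  by (rule timed_triple_Loop) (simp add: scan_state_def represents_def)

lemma round_triple:
  assumes "auction_inv n cost B price owner bidder m" and "bidder \<le> n"
  shows "triple (represents price owner bidder m)
     (Seq (first_offer_prog d) (Seq (Loop rJ (next_offer_prog d)) award_prog)) (round_degree d)
     (\<lambda>s. \<exists>i<remaining_raises n B price. auction_state i s)"
  unfolding round_degree_def
  by (rule timed_triple_Seq[OF first_offer_triple
        timed_triple_Seq[OF scan_loop_triple award_triple V_ge_2] V_ge_2]) (fact assms)+

lemma auction_triple:
  "triple (auction_state (n * (B + 1))) (auction_prog d) (auction_degree d)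
     (\<lambda>s. (\<exists>i. auction_state i s) \<and> \<not> expr_val s (Sub (Add rN (Num 1)) rBidder) > 0)"
  unfolding auction_prog_def auction_degree_def
proof (rule timed_triple_Loop[OF V_ge_2 raises_less])
  fix i s assume "auction_state i s"
  then show "bounded_state V s"
    by (auto simp: auction_state_def represents_def)
next
  fix i
  show "triple (\<lambda>s. auction_state i s \<and> expr_val s (Sub (Add rN (Num 1)) rBidder) > 0)
     (Seq (first_offer_prog d) (Seq (Loop rJ (next_offer_prog d)) award_prog)) (round_degree d)
     (\<lambda>s. \<exists>i'<i. auction_state i' s)"
    unfolding timed_triple_def
  proof (intro allI impI)
    fix s assume s: "auction_state i s \<and> expr_val s (Sub (Add rN (Num 1)) rBidder) > 0"
    then obtain price owner bidder m where inv: "auction_inv n cost B price owner bidder m"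
      and rep: "represents price owner bidder m s" and i: "remaining_raises n B price = i"
      unfolding auction_state_def by blast
    have "bidder \<le> n"
      using s rep by (simp add: represents_def)
    from round_triple[OF inv this] rep i
    show "\<exists>t s'. exec d orc (Seq (first_offer_prog d) (Seq (Loop rJ (next_offer_prog d)) award_prog))
        s t 0 s' \<and> t \<le> V ^ round_degree d \<and> (\<exists>i'<i. auction_state i' s')"
      unfolding timed_triple_def by blast
  qed
qed

text \<open>Invariant of the output loop: objects above \<open>i\<close> have been reported to their owners. Reports
  go to positive addresses, so the table of owners stays intact.\<close>

definition output_state :: "(nat \<Rightarrow> nat) \<Rightarrow> nat \<Rightarrow> state \<Rightarrow> bool" where
  "output_state owner i s \<longleftrightarrow> fst s 3 = int i \<and> i \<le> n \<and> bounded_state V s \<and>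
     (\<forall>j\<in>{1..n}. snd s (-2 * int j - 1) = int (owner j)) \<and>
     (\<forall>j\<in>{i + 1..n}. snd s (int (owner j)) = int j)"

lemma output_step_triple:
  assumes bij: "bij_betw owner {1..n} {1..n}"
  shows "triple (\<lambda>s. output_state owner i s \<and> expr_val s rJ > 0)
     (Seq (Store (Mem (owner_cell rJ)) rJ) (Assign 3 (Sub rJ (Num 1))))
     (prog_degree (Seq (Store (Mem (owner_cell rJ)) rJ) (Assign 3 (Sub rJ (Num 1)))))
     (\<lambda>s. \<exists>i'<i. output_state owner i' s)"
proof (rule timed_triple_straight_line[OF _ V_ge_2])
  fix s assume s: "output_state owner i s \<and> expr_val s rJ > 0"
  then show "bounded_state V s" by (simp add: output_state_def)
  have i: "i \<in> {1..n}" and J: "fst s 3 = int i"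
    using s by (auto simp: output_state_def)
  have ne: "owner j \<noteq> owner i" if "j \<in> {1..n}" "j \<noteq> i" for j
    using bij i that unfolding bij_betw_def by (blast dest: inj_onD)
  have run: "run (Seq (Store (Mem (owner_cell rJ)) rJ) (Assign 3 (Sub rJ (Num 1)))) s
      = ((fst s)(3 := int (i - 1)), (snd s)(int (owner i) := int i))"
    using s i J by (auto simp: output_state_def of_nat_diff)
  have "((snd s)(int (owner i) := int i)) (int (owner j)) = int j" if "j \<in> {i..n}" for j
    using s that ne[of j] i by (cases "j = i") (auto simp: output_state_def)
  then have "output_state owner (i - 1) (run (Seq (Store (Mem (owner_cell rJ)) rJ) (Assign 3 (Sub rJ (Num 1)))) s)"
    unfolding run using s i V_ge by (auto simp: output_state_def bounded_state_def)
  with i show "\<exists>i'<i. output_state owner i' (run (Seq (Store (Mem (owner_cell rJ)) rJ) (Assign 3 (Sub rJ (Num 1)))) s)"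
    by (intro exI[of _ "i - 1"]) auto
qed simp

lemma output_state_final:
  assumes bij: "bij_betw owner {1..n} {1..n}"
    and s: "output_state owner i s" "\<not> expr_val s rJ > 0"
  shows "output_edges n s = matching_of n owner"
proof -
  have "snd s (int (owner j)) = int j" if "j \<in> {1..n}" for j
    using s that by (auto simp: output_state_def)
  then have "(\<lambda>j. (owner j, nat (snd s (int (owner j))))) ` {1..n} = matching_of n owner"
    unfolding matching_of_def by (intro image_cong) auto
  moreover have "output_edges n s = (\<lambda>i. (i, nat (snd s (int i)))) ` owner ` {1..n}"
    using bij by (auto simp: output_edges_def bij_betw_def)
  ultimately show ?thesis
    by (simp add: image_image)
qed

definition optimal_output :: "state \<Rightarrow> bool" where
  "optimal_output s \<longleftrightarrow> output_edges n s \<in> perfect_matchings n \<and>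
     (\<forall>M\<in>perfect_matchings n.
        set_weight (total_weight d w) (output_edges n s) \<le> set_weight (total_weight d w) M)"

lemma output_triple:
  "triple (\<lambda>s. (\<exists>i. auction_state i s) \<and> \<not> expr_val s (Sub (Add rN (Num 1)) rBidder) > 0)
     output_prog output_degree optimal_output"
  unfolding timed_triple_def
proof (intro allI impI)
  fix s assume s: "(\<exists>i. auction_state i s) \<and> \<not> expr_val s (Sub (Add rN (Num 1)) rBidder) > 0"
  then obtain price owner bidder m where inv: "auction_inv n cost B price owner bidder m"
    and rep: "represents price owner bidder m s"
    unfolding auction_state_def by blast
  have "\<not> bidder \<le> n"
    using s rep by (simp add: represents_def)
  note fin = auction_finished[OF inv this]
  have opt: "optimal_output s'" if "(\<exists>i. output_state owner i s') \<and> \<not> expr_val s' rJ > 0" for s'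
  proof -
    have "output_edges n s' = matching_of n owner"
      using that output_state_final[OF fin(1)] by blast
    then show ?thesis
      unfolding optimal_output_def
      using matching_of_perfect[OF fin(1)] almost_equilibrium_optimal[where v = "total_weight d w" and price = price, OF fin] by metis
  qed
  have "triple (represents price owner bidder m) (Assign 3 rN) (prog_degree (Assign 3 rN))
      (output_state owner n)"
    using V_ge by (intro timed_triple_straight_line V_ge_2)
      (auto simp: represents_def output_state_def bounded_state_def)
  moreover have "triple (output_state owner n)
      (Loop rJ (Seq (Store (Mem (owner_cell rJ)) rJ) (Assign 3 (Sub rJ (Num 1)))))
      (expr_degree rJ + prog_degree (Seq (Store (Mem (owner_cell rJ)) rJ) (Assign 3 (Sub rJ (Num 1)))) + 4)
      (\<lambda>s. (\<exists>i. output_state owner i s) \<and> \<not> expr_val s rJ > 0)"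
    using V_ge_2 n_less _ output_step_triple[OF fin(1)]
    by (rule timed_triple_Loop) (simp add: output_state_def)
  ultimately have "triple (represents price owner bidder m) output_prog output_degree
      (\<lambda>s. (\<exists>i. output_state owner i s) \<and> \<not> expr_val s rJ > 0)"
    unfolding output_prog_def output_degree_def by (rule timed_triple_Seq) (rule V_ge_2)
  with rep opt show "\<exists>t s'. exec d orc output_prog s t 0 s' \<and> t \<le> V ^ output_degree \<and> optimal_output s'"
    unfolding timed_triple_def by blast
qed

lemma matching_prog_correct:
  "\<exists>t s. exec d orc (matching_prog d) (initial_state (input_list d n w)) t 0 s \<and>
     t \<le> V ^ matching_degree d \<and> optimal_output s"
  using timed_triple_Seq[OF setup_triple timed_triple_Seq[OF auction_triple output_triple V_ge_2] V_ge_2]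
  unfolding timed_triple_def matching_prog_def matching_degree_def by blast

end

section \<open>Approximation by the sum of the weights\<close>

text \<open>The surrogate objective is the \<open>l\<^sub>1\<close> norm of the weight vector. It is linear in the matching, so that
  minimizing it is an ordinary assignment problem.\<close>

lemma sum_weight_vector:
  "(\<Sum>t\<leftarrow>weight_vector d w M. \<bar>t\<bar>) = real (set_weight (total_weight d w) M)"
proof -
  have "(\<Sum>t\<leftarrow>weight_vector d w M. \<bar>t\<bar>) = (\<Sum>k\<in>{1..<d + 1}. real (set_weight (w k) M))"
    unfolding weight_vector_def map_map
    by (subst interv_sum_list_conv_sum_set_nat) (simp del: upt_Suc)
  also have "\<dots> = (\<Sum>k<d. real (set_weight (w (k + 1)) M))"
    by (rule sum.reindex_bij_witness[of _ Suc "\<lambda>k. k - 1"]) auto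
  also have "\<dots> = real (set_weight (total_weight d w) M)"
    unfolding set_weight_def total_weight_def split_def of_nat_sum by (rule sum.swap)
  finally show ?thesis .
qed

lemma length_weight_vector: "length (weight_vector d w M) = d"
  by (simp add: weight_vector_def)

lemma total_weight_le:
  assumes "i \<in> {1..n}" and "j \<in> {1..n}"
  shows "total_weight d w i j \<le> d * max_weight d n w"
proof -
  let ?W = "{w k i j | k i j. k \<in> {1..d} \<and> i \<in> {1..n} \<and> j \<in> {1..n}}"
  have "?W = (\<lambda>(k, i, j). w k i j) ` ({1..d} \<times> {1..n} \<times> {1..n})"
    by force
  then have fin: "finite ?W" by simp
  have "w (k + 1) i j \<le> max_weight d n w" if "k < d" for k
    unfolding max_weight_def using fin
  proof (rule Max_ge)
    have "k + 1 \<in> {1..d}" using that by simp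
    with assms show "w (k + 1) i j \<in> ?W" by blast
  qed
  then show ?thesis
    unfolding total_weight_def using sum_bounded_above[of "{..<d}" "\<lambda>k. w (k + 1) i j"] by simp
qed

theorem theorem4p1:
  fixes d :: nat
  assumes "d \<ge> 1"
  shows "\<exists>(A :: prog) (q :: nat poly poly).
    \<forall>(n :: nat) (p :: ereal) (w :: nat \<Rightarrow> nat \<Rightarrow> nat \<Rightarrow> nat). n \<ge> 1 \<longrightarrow> 1 \<le> p \<longrightarrow>
      (\<exists>t m s. exec d (comparison_oracle (lp_norm p)) A (initial_state (input_list d n w)) t m s
        \<and> t + m \<le> poly2 q n (max_weight d n w)
        \<and> approximative_min (real d) (perfect_matchings n)
            (\<lambda>M. lp_norm p (weight_vector d w M)) (output_edges n s)
        \<and> (p = 2 \<longrightarrow> approximative_min (sqrt (real d)) (perfect_matchings n)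
            (\<lambda>M. lp_norm p (weight_vector d w M)) (output_edges n s)))"
proof (rule exI[of _ "matching_prog d"],
    rule exI[of _ "[:[:2, 2 * d:], [:1, 2 * d:]:] ^ matching_degree d"], intro allI impI)
  fix n :: nat and p :: ereal and w :: "nat \<Rightarrow> nat \<Rightarrow> nat \<Rightarrow> nat"
  assume n: "n \<ge> 1" and p: "1 \<le> p"
  define B where "B = (n + 1) * (d * max_weight d n w)"
  define V where "V = 2 * B + n + 2"
  interpret auction_input d "comparison_oracle (lp_norm p)" n w B V
  proof
    fix i j assume "i \<in> {1..n}" "j \<in> {1..n}"
    then show "(n + 1) * total_weight d w i j \<le> B"
      unfolding B_def by (intro mult_left_mono total_weight_le) auto
  qed (use n in \<open>simp_all add: V_def\<close>)
  obtain t s where run: "exec d (comparison_oracle (lp_norm p)) (matching_prog d)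
      (initial_state (input_list d n w)) t 0 s"
    and t: "t \<le> V ^ matching_degree d" and opt: "optimal_output s"
    using matching_prog_correct by blast
  \<comment> \<open>\<open>V = (2 + 2 d W) + (1 + 2 d W) n\<close>, where \<open>W\<close> is the largest weight.\<close>
  have "poly2 ([:[:2, 2 * d:], [:1, 2 * d:]:] ^ matching_degree d) n (max_weight d n w)
      = V ^ matching_degree d"
    by (simp add: poly2_def poly_power V_def B_def algebra_simps)
  with t have time: "t + 0 \<le> poly2 ([:[:2, 2 * d:], [:1, 2 * d:]:] ^ matching_degree d) n (max_weight d n w)"
    by simp
  let ?g = "\<lambda>M. lp_norm p (weight_vector d w M)"
  have approx: "approximative_min r (perfect_matchings n) ?g (output_edges n s)"
    if r: "1 \<le> r" "\<And>M. (\<Sum>t\<leftarrow>weight_vector d w M. \<bar>t\<bar>) \<le> r * ?g M" for r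
  proof (rule surrogate_minimizer_approximative[OF finite_perfect_matchings])
    fix M
    \<comment> \<open>As \<open>d \<ge> 1\<close>, there is a coordinate, whose absolute value is a lower bound of the norm.\<close>
    have ne: "weight_vector d w M \<noteq> []"
      using assms length_weight_vector[of d w M] by force
    then have "\<bar>hd (weight_vector d w M)\<bar> \<le> ?g M"
      using p by (intro abs_le_lp_norm) auto
    then have "0 \<le> ?g M" by linarith
    with lp_norm_le_sum[OF p ne] r(2)[of M]
    show "0 \<le> ?g M \<and> ?g M \<le> real (set_weight (total_weight d w) M) \<and>
        real (set_weight (total_weight d w) M) \<le> r * ?g M"
      by (simp add: sum_weight_vector)
  qed (use opt r in \<open>auto simp: optimal_output_def\<close>)
  have "approximative_min (real d) (perfect_matchings n) ?g (output_edges n s)"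
    using assms sum_le_length_lp_norm[OF p, of "weight_vector d w _"]
    by (intro approx) (auto simp: length_weight_vector)
  moreover have "approximative_min (sqrt (real d)) (perfect_matchings n) ?g (output_edges n s)" if "p = 2"
    using assms that sum_le_sqrt_length_euclidean_norm[of "weight_vector d w _"]
    by (intro approx) (auto simp: length_weight_vector)
  ultimately show "\<exists>t m s. exec d (comparison_oracle (lp_norm p)) (matching_prog d)
        (initial_state (input_list d n w)) t m s
      \<and> t + m \<le> poly2 ([:[:2, 2 * d:], [:1, 2 * d:]:] ^ matching_degree d) n (max_weight d n w)
      \<and> approximative_min (real d) (perfect_matchings n) ?g (output_edges n s)
      \<and> (p = 2 \<longrightarrow> approximative_min (sqrt (real d)) (perfect_matchings n) ?g (output_edges n s))"
    using run time by blast
qed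

end
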